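(* Let $R$ be an étale $A$-algebra. Define $T^0(R)$ as in the context and recursively, for $m\ge0$, $T^{m+1}(R)=\{X\in T^m(R): \varphi_{0,R}(X)\in\psi_{0,R}(T^m(R))\text{ and }\varphi_{0,R}(X^{ad})\in\psi_{0,R}(T^m(R))\}$. Then for every $m\ge0$: $T^{m+1}(R)$ is well-defined and is an additive group; for all $X,Y\in T^m(R)$ one has $X^{ad}\cdot Y\in T^m(R)$; and both $\psi_{m,R}:=\psi_{0,R}|_{T^m(R)}:T^m(R)\to H^0(R)$ and $\overline{\varphi_{m,R}}:T^m(R)\to H^0(R)/\psi_{0,R}(T^m(R))$ (restriction of $\varphi_{0,R}$ followed by the quotient map) are group homomorphisms.
   Context: $F$ is a non-Archimedean local field with ring of integers $A$ and residue characteristic $p$. $(K,\sigma)$ is one of: $K=F$ with $\mathrm{char}\,F\neq2$, $\sigma=\mathrm{id}$; $K=E$ a separable quadratic extension with nontrivial automorphism $\sigma$; $K=F\oplus F$, $\sigma(x,y)=(y,x)$; $K=D$ the quaternion division algebra with standard involution. $B$ is the maximal $A$-order of $K$; $\epsilon\in\{\pm1\}$. If $(K,\epsilon,p)\ne(F,1,2)$, $L$ is a free right $B$-module of rank $n$ with a $(\sigma,\epsilon)$-hermitian form $h:L\times L\to B$ and "hermitian form" means such a form; if $(K,\epsilon,p)=(F,1,2)$, $L$ is a free $A$-module of rank $n$ with quadratic form $h$, $h(v,w)=\frac12(h(v+w)-h(v)-h(w))$, and "hermitian form" means quadratic form (conditions/formulas via the associated bilinear form). $V=L\otimes_AF$ is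 nondegenerate; $L^{\#}=\{x\in V:h(x,L)\subset B\}$ and $(L^{\#})^{\#}=L$ is assumed. Adjoint $X^{ad}$: $h(X(v),w)=h(v,X^{ad}(w))$. For a flat $A$-algebra $R$: $T^0(R)=\{X\in\mathrm{End}_{B\otimes R}(L\otimes R):X(L^{\#}\otimes R)\subset L^{\#}\otimes R\}$; $H^0(R)$ = hermitian forms $f$ on $L\otimes R$ with $f(L\otimes R,L^{\#}\otimes R)\subset B\otimes R$; $\varphi_{0,R}(X)=h\circ X$ with $(h\circ X)(v,w)=h(X(v),X(w))$; $\psi_{0,R}(X)(v,w)=h(v,X(w))+h(X(v),w)$. *)

theory Defs
  imports
    Complex_Main
    "HOL-Library.Poly_Mapping"
    "HOL-Library.Function_Algebras"
    "HOL-Computational_Algebra.Polynomial"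
    "HOL-Algebra.Coset"
begin

section \<open>Non-Archimedean local fields\<close>

text \<open>A local field is given by its normalised discrete valuation; the value of the valuation
  at 0 is irrelevant, because \<^term>\<open>val_ge \<nu> N\<close> always contains 0.\<close>

definition val_ge :: "('f::field \<Rightarrow> int) \<Rightarrow> int \<Rightarrow> 'f set" where
  "val_ge \<nu> N = {x. x = 0 \<or> N \<le> \<nu> x}"

abbreviation val_ring :: "('f::field \<Rightarrow> int) \<Rightarrow> 'f set" where
  "val_ring \<nu> \<equiv> val_ge \<nu> 0"

abbreviation val_max_ideal :: "('f::field \<Rightarrow> int) \<Rightarrow> 'f set" where
  "val_max_ideal \<nu> \<equiv> val_ge \<nu> 1"

definition nonarch_local_field :: "('f::field \<Rightarrow> int) \<Rightarrow> bool" where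
  "nonarch_local_field \<nu> \<longleftrightarrow>
     (\<forall>x y. x \<noteq> 0 \<longrightarrow> y \<noteq> 0 \<longrightarrow> \<nu> (x * y) = \<nu> x + \<nu> y) \<and>
     (\<forall>x y. x \<noteq> 0 \<longrightarrow> y \<noteq> 0 \<longrightarrow> x + y \<noteq> 0 \<longrightarrow> min (\<nu> x) (\<nu> y) \<le> \<nu> (x + y)) \<and>
     (\<exists>x. x \<noteq> 0 \<and> \<nu> x = 1) \<and>
     (\<forall>s::nat \<Rightarrow> 'f. (\<forall>N. \<exists>k. \<forall>i\<ge>k. \<forall>j\<ge>k. s i - s j \<in> val_ge \<nu> N) \<longrightarrow>
        (\<exists>l. \<forall>N. \<exists>k. \<forall>i\<ge>k. s i - l \<in> val_ge \<nu> N)) \<and>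
     finite (val_ring \<nu> //
       {(x, y). x \<in> val_ring \<nu> \<and> y \<in> val_ring \<nu> \<and> x - y \<in> val_max_ideal \<nu>})"

definition residue_char :: "('f::field \<Rightarrow> int) \<Rightarrow> nat" where
  "residue_char \<nu> = (LEAST p. 0 < p \<and> of_nat p \<in> val_max_ideal \<nu>)"

section \<open>The algebra with involution and its maximal order\<close>

definition unital_ring_hom_on ::
  "'a::{ring,monoid_mult} set \<Rightarrow> ('a \<Rightarrow> 'b::{ring,monoid_mult}) \<Rightarrow> bool" where
  "unital_ring_hom_on S f \<longleftrightarrow>
     f 1 = 1 \<and> (\<forall>x\<in>S. \<forall>y\<in>S. f (x + y) = f x + f y \<and> f (x * y) = f x * f y)"

definition ring_center :: "'k::ring set" where
  "ring_center = {z. \<forall>x. z * x = x * z}"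

definition algebra_dim :: "('f::field \<Rightarrow> 'k::ring_1) \<Rightarrow> nat" where
  "algebra_dim \<iota> = vector_space.dim (\<lambda>a x. \<iota> a * x) (UNIV :: 'k set)"

definition is_division_ring :: "'k::ring_1 itself \<Rightarrow> bool" where
  "is_division_ring _ \<longleftrightarrow> (\<forall>x::'k. x \<noteq> 0 \<longrightarrow> (\<exists>y. x * y = 1 \<and> y * x = 1))"

definition base_field_case :: "('f::field \<Rightarrow> 'k::ring_1) \<Rightarrow> ('k \<Rightarrow> 'k) \<Rightarrow> bool" where
  "base_field_case \<iota> \<sigma> \<longleftrightarrow> bij \<iota> \<and> CHAR('f) \<noteq> 2 \<and> \<sigma> = id"

definition separable_quadratic_case :: "('f::field \<Rightarrow> 'k::ring_1) \<Rightarrow> ('k \<Rightarrow> 'k) \<Rightarrow> bool" where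
  "separable_quadratic_case \<iota> \<sigma> \<longleftrightarrow>
     is_division_ring TYPE('k) \<and> (\<forall>x y::'k. x * y = y * x) \<and> algebra_dim \<iota> = 2 \<and>
     (\<forall>x::'k. \<exists>f::'f poly. coprime f (pderiv f) \<and> (\<Sum>i\<le>degree f. \<iota> (coeff f i) * x ^ i) = 0) \<and>
     bij \<sigma> \<and> unital_ring_hom_on UNIV \<sigma> \<and> (\<forall>a. \<sigma> (\<iota> a) = \<iota> a) \<and> \<sigma> \<noteq> id"

definition split_case :: "('f::field \<Rightarrow> 'k::ring_1) \<Rightarrow> ('k \<Rightarrow> 'k) \<Rightarrow> bool" where
  "split_case \<iota> \<sigma> \<longleftrightarrow>
     (\<exists>\<Phi> :: 'k \<Rightarrow> 'f \<times> 'f. bij \<Phi> \<and>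
        (\<forall>x y. \<Phi> (x + y) = (fst (\<Phi> x) + fst (\<Phi> y), snd (\<Phi> x) + snd (\<Phi> y)) \<and>
               \<Phi> (x * y) = (fst (\<Phi> x) * fst (\<Phi> y), snd (\<Phi> x) * snd (\<Phi> y))) \<and>
        (\<forall>a. \<Phi> (\<iota> a) = (a, a)) \<and>
        (\<forall>x. \<Phi> (\<sigma> x) = prod.swap (\<Phi> x)))"

text \<open>A quaternion division algebra is a central division algebra of dimension 4. Its standard
  involution is the unique involution of the first kind for which every \<open>x \<sigma>(x)\<close> is a scalar.\<close>

definition quaternion_case :: "('f::field \<Rightarrow> 'k::ring_1) \<Rightarrow> ('k \<Rightarrow> 'k) \<Rightarrow> bool" where
  "quaternion_case \<iota> \<sigma> \<longleftrightarrow>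
     is_division_ring TYPE('k) \<and> (ring_center :: 'k set) = range \<iota> \<and> algebra_dim \<iota> = 4 \<and>
     additive \<sigma> \<and> (\<forall>x y. \<sigma> (x * y) = \<sigma> y * \<sigma> x) \<and> (\<forall>x. \<sigma> (\<sigma> x) = x) \<and>
     (\<forall>a. \<sigma> (\<iota> a) = \<iota> a) \<and> (\<forall>x. x * \<sigma> x \<in> range \<iota>)"

definition algebra_with_involution :: "('f::field \<Rightarrow> 'k::ring_1) \<Rightarrow> ('k \<Rightarrow> 'k) \<Rightarrow> bool" where
  "algebra_with_involution \<iota> \<sigma> \<longleftrightarrow>
     unital_ring_hom_on UNIV \<iota> \<and> range \<iota> \<subseteq> ring_center \<and>
     (base_field_case \<iota> \<sigma> \<or> separable_quadratic_case \<iota> \<sigma> \<or> split_case \<iota> \<sigma> \<or> quaternion_case \<iota> \<sigma>)"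

definition is_order :: "'f::field set \<Rightarrow> ('f \<Rightarrow> 'k::ring_1) \<Rightarrow> 'k set \<Rightarrow> bool" where
  "is_order A \<iota> B \<longleftrightarrow>
     1 \<in> B \<and> (\<forall>x\<in>B. \<forall>y\<in>B. x - y \<in> B \<and> x * y \<in> B) \<and>
     (\<exists>S. finite S \<and> B = {\<Sum>s\<in>S. \<iota> (c s) * s | c. \<forall>s\<in>S. c s \<in> A}) \<and>
     (\<forall>x. \<exists>a. a \<noteq> 0 \<and> \<iota> a * x \<in> B)"

definition is_maximal_order :: "'f::field set \<Rightarrow> ('f \<Rightarrow> 'k::ring_1) \<Rightarrow> 'k set \<Rightarrow> bool" where
  "is_maximal_order A \<iota> B \<longleftrightarrow>
     is_order A \<iota> B \<and> (\<forall>B'. is_order A \<iota> B' \<and> B \<subseteq> B' \<longrightarrow> B' = B)"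

section \<open>Right modules, lattices and forms\<close>

definition biadditive :: "('a::ab_group_add \<Rightarrow> 'b::ab_group_add \<Rightarrow> 'c::ab_group_add) \<Rightarrow> bool" where
  "biadditive f \<longleftrightarrow> (\<forall>x. additive (f x)) \<and> (\<forall>y. additive (\<lambda>x. f x y))"

definition right_module :: "('v::ab_group_add \<Rightarrow> 'k::{ring,monoid_mult} \<Rightarrow> 'v) \<Rightarrow> bool" where
  "right_module act \<longleftrightarrow>
     biadditive act \<and> (\<forall>x a b. act x (a * b) = act (act x a) b) \<and> (\<forall>x. act x 1 = x)"

definition module_endo ::
  "('w::ab_group_add \<Rightarrow> 's::{ring,monoid_mult} \<Rightarrow> 'w) \<Rightarrow> ('w \<Rightarrow> 'w) \<Rightarrow> bool" where
  "module_endo act X \<longleftrightarrow> additive X \<and> (\<forall>x a. X (act x a) = act (X x) a)"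

definition free_of_rank ::
  "('v::ab_group_add \<Rightarrow> 'k::ring_1 \<Rightarrow> 'v) \<Rightarrow> 'k set \<Rightarrow> nat \<Rightarrow> 'v set \<Rightarrow> bool" where
  "free_of_rank act B n L \<longleftrightarrow>
     (\<exists>e :: nat \<Rightarrow> 'v.
        L = {\<Sum>i<n. act (e i) (b i) | b. \<forall>i<n. b i \<in> B} \<and>
        (\<forall>b. (\<forall>i<n. b i \<in> B) \<longrightarrow> (\<Sum>i<n. act (e i) (b i)) = 0 \<longrightarrow> (\<forall>i<n. b i = 0)))"

text \<open>\<open>L\<close> is a free right \<open>B\<close>-module of rank \<open>n\<close> and the ambient \<open>K\<close>-module is \<open>L \<otimes>\<^sub>A F\<close>:
  \<open>F\<close> is the fraction field of \<open>A\<close>, so this means that \<open>L\<close> is a \<open>B\<close>-submodule whose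
  \<open>F\<close>-multiples exhaust the ambient space.\<close>

definition free_lattice ::
  "('f::field \<Rightarrow> 'k::ring_1) \<Rightarrow> ('v::ab_group_add \<Rightarrow> 'k \<Rightarrow> 'v) \<Rightarrow> 'k set \<Rightarrow> nat \<Rightarrow> 'v set \<Rightarrow> bool" where
  "free_lattice \<iota> act B n L \<longleftrightarrow>
     free_of_rank act B n L \<and> (\<forall>x. \<exists>a. a \<noteq> 0 \<and> act x (\<iota> a) \<in> L)"

text \<open>The sign \<open>\<epsilon>\<close> is an element of the ring in which the form takes its values.\<close>

definition hermitian_form ::
  "('w::ab_group_add \<Rightarrow> 's::{ring,monoid_mult} \<Rightarrow> 'w) \<Rightarrow> ('s \<Rightarrow> 's) \<Rightarrow> 's \<Rightarrow> ('w \<Rightarrow> 'w \<Rightarrow> 's) \<Rightarrow> bool" where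
  "hermitian_form act \<sigma> \<epsilon> f \<longleftrightarrow>
     biadditive f \<and>
     (\<forall>x y a b. f (act x a) (act y b) = \<sigma> a * f x y * b) \<and>
     (\<forall>x y. f y x = \<epsilon> * \<sigma> (f x y))"

text \<open>The argument \<open>half\<close> is the inverse of 2 in the ring of values.\<close>

definition assoc_bilinear :: "'s::ring \<Rightarrow> ('w::ab_group_add \<Rightarrow> 's) \<Rightarrow> 'w \<Rightarrow> 'w \<Rightarrow> 's" where
  "assoc_bilinear half q x y = half * (q (x + y) - q x - q y)"

definition quadratic_form ::
  "('w::ab_group_add \<Rightarrow> 's::{ring,monoid_mult} \<Rightarrow> 'w) \<Rightarrow> 's \<Rightarrow> ('w \<Rightarrow> 's) \<Rightarrow> bool" where
  "quadratic_form act half q \<longleftrightarrow>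
     (\<forall>x a. q (act x a) = q x * a ^ 2) \<and> hermitian_form act id 1 (assoc_bilinear half q)"

definition nondegenerate :: "('w::zero \<Rightarrow> 'w \<Rightarrow> 's::zero) \<Rightarrow> bool" where
  "nondegenerate h \<longleftrightarrow> (\<forall>x. (\<forall>y. h x y = 0) \<longrightarrow> x = 0)"

definition dual_lattice :: "('v \<Rightarrow> 'v \<Rightarrow> 'k) \<Rightarrow> 'k set \<Rightarrow> 'v set \<Rightarrow> 'v set" where
  "dual_lattice h B L = {x. \<forall>y\<in>L. h x y \<in> B}"


section \<open>Tensor products\<close>

definition add_subgroup :: "'a::ab_group_add set \<Rightarrow> bool" where
  "add_subgroup H \<longleftrightarrow> 0 \<in> H \<and> (\<forall>x\<in>H. \<forall>y\<in>H. x - y \<in> H)"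

text \<open>The relations which cut \<open>M \<otimes>\<^sub>A N\<close> out of the free abelian group on \<open>M \<times> N\<close>; here \<open>M\<close> and
  \<open>N\<close> are \<open>A\<close>-stable subgroups of the ambient types, with scalar multiplications \<open>sm\<close> and \<open>sn\<close>.\<close>

definition tensor_relations ::
  "'a set \<Rightarrow> 'm::ab_group_add set \<Rightarrow> ('a \<Rightarrow> 'm \<Rightarrow> 'm) \<Rightarrow> 'n::ab_group_add set \<Rightarrow> ('a \<Rightarrow> 'n \<Rightarrow> 'n) \<Rightarrow>
     ('m \<times> 'n \<Rightarrow>\<^sub>0 int) set" where
  "tensor_relations A M sm N sn = add_subgroup hull
     ({frag_of (x + x', y) - frag_of (x, y) - frag_of (x', y) | x x' y. x \<in> M \<and> x' \<in> M \<and> y \<in> N} \<union>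
      {frag_of (x, y + y') - frag_of (x, y) - frag_of (x, y') | x y y'. x \<in> M \<and> y \<in> N \<and> y' \<in> N} \<union>
      {frag_of (sm a x, y) - frag_of (x, sn a y) | a x y. a \<in> A \<and> x \<in> M \<and> y \<in> N})"

text \<open>The abelian group \<open>'t\<close> together with the pure tensors \<open>t x y\<close> is a tensor product
  \<open>'m \<otimes>\<^sub>A 'n\<close>: the map of the free abelian group that sends each generator to the pure tensor
  identifies \<open>'t\<close> with the quotient by the tensor relations.\<close>

definition is_tensor_product ::
  "'a set \<Rightarrow> ('a \<Rightarrow> 'm \<Rightarrow> 'm) \<Rightarrow> ('a \<Rightarrow> 'n \<Rightarrow> 'n) \<Rightarrow>
     ('m::ab_group_add \<Rightarrow> 'n::ab_group_add \<Rightarrow> 't::ab_group_add) \<Rightarrow> bool" where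
  "is_tensor_product A sm sn t \<longleftrightarrow>
     (\<exists>\<pi> :: ('m \<times> 'n \<Rightarrow>\<^sub>0 int) \<Rightarrow> 't.
        additive \<pi> \<and> surj \<pi> \<and> (\<forall>x y. \<pi> (frag_of (x, y)) = t x y) \<and>
        {z. \<pi> z = 0} = tensor_relations A UNIV sm UNIV sn)"

text \<open>The additive map on a tensor product induced by a balanced biadditive map \<open>g\<close>.\<close>

definition tensor_lift ::
  "('m \<Rightarrow> 'n \<Rightarrow> 't::ab_group_add) \<Rightarrow> ('m \<Rightarrow> 'n \<Rightarrow> 'g::ab_group_add) \<Rightarrow> 't \<Rightarrow> 'g" where
  "tensor_lift t g = (THE G. additive G \<and> (\<forall>x y. G (t x y) = g x y))"

section \<open>Etale algebras\<close>

text \<open>The sort of \<open>'r\<close> is that of commutative rings with unit, the zero ring included.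
  Etale means flat, of finite presentation and unramified.\<close>

definition is_ideal_of :: "'f::comm_ring set \<Rightarrow> 'f set \<Rightarrow> bool" where
  "is_ideal_of A I \<longleftrightarrow> I \<subseteq> A \<and> add_subgroup I \<and> (\<forall>a\<in>A. \<forall>x\<in>I. a * x \<in> I)"

text \<open>Flatness: \<open>I \<otimes>\<^sub>A R \<rightarrow> R\<close> is injective for all ideals \<open>I\<close> of \<open>A\<close>. (HOL cannot quantify over
  all \<open>A\<close>-modules inside a formula.)\<close>

definition flat_algebra ::
  "'f::field set \<Rightarrow> ('f \<Rightarrow> 'r::{comm_ring,comm_monoid_mult}) \<Rightarrow> bool" where
  "flat_algebra A \<alpha> \<longleftrightarrow>
     (\<forall>I. is_ideal_of A I \<longrightarrow>
        (\<forall>(k::nat) a r. (\<forall>i<k. a i \<in> I) \<longrightarrow> (\<Sum>i<k. \<alpha> (a i) * r i) = 0 \<longrightarrow>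
           (\<Sum>i<k. frag_of (a i, r i)) \<in>
             tensor_relations A I (\<lambda>c x. c * x) UNIV (\<lambda>c y. \<alpha> c * y)))"

definition poly_ring :: "'f::field set \<Rightarrow> nat \<Rightarrow> ((nat \<Rightarrow>\<^sub>0 nat) \<Rightarrow>\<^sub>0 'f) set" where
  "poly_ring A N =
     {p. \<forall>m\<in>Poly_Mapping.keys p. Poly_Mapping.keys m \<subseteq> {..<N} \<and> Poly_Mapping.lookup p m \<in> A}"

definition poly_value ::
  "('f::field \<Rightarrow> 'r::{comm_ring,comm_monoid_mult}) \<Rightarrow> (nat \<Rightarrow> 'r) \<Rightarrow> ((nat \<Rightarrow>\<^sub>0 nat) \<Rightarrow>\<^sub>0 'f) \<Rightarrow> 'r" where
  "poly_value \<alpha> r p =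
     (\<Sum>m\<in>Poly_Mapping.keys p. \<alpha> (Poly_Mapping.lookup p m) *
        (\<Prod>i\<in>Poly_Mapping.keys m. r i ^ Poly_Mapping.lookup m i))"

definition finitely_presented_algebra ::
  "'f::field set \<Rightarrow> ('f \<Rightarrow> 'r::{comm_ring,comm_monoid_mult}) \<Rightarrow> bool" where
  "finitely_presented_algebra A \<alpha> \<longleftrightarrow>
     (\<exists>N r. poly_value \<alpha> r ` poly_ring A N = UNIV \<and>
        (\<exists>G. finite G \<and> G \<subseteq> poly_ring A N \<and>
           {p \<in> poly_ring A N. poly_value \<alpha> r p = 0} =
             {\<Sum>g\<in>G. c g * g | c. \<forall>g\<in>G. c g \<in> poly_ring A N}))"

text \<open>The module of Kaehler differentials is the quotient of the free \<open>R\<close>-module on symbols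
  \<open>dx\<close> (\<open>single x c\<close> stands for \<open>c dx\<close>) by the relations below; unramified means that it vanishes.\<close>

definition kaehler_relations ::
  "'f set \<Rightarrow> ('f \<Rightarrow> 'r::{comm_ring,comm_monoid_mult}) \<Rightarrow> ('r \<Rightarrow>\<^sub>0 'r) set" where
  "kaehler_relations A \<alpha> = add_subgroup hull
     ({Poly_Mapping.single (x + y) c - Poly_Mapping.single x c - Poly_Mapping.single y c | x y c. True} \<union>
      {Poly_Mapping.single (x * y) c - Poly_Mapping.single x (c * y) - Poly_Mapping.single y (c * x) | x y c. True} \<union>
      {Poly_Mapping.single (\<alpha> a) c | a c. a \<in> A})"

definition unramified_algebra ::
  "'f set \<Rightarrow> ('f \<Rightarrow> 'r::{comm_ring,comm_monoid_mult}) \<Rightarrow> bool" where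
  "unramified_algebra A \<alpha> \<longleftrightarrow> kaehler_relations A \<alpha> = UNIV"

text \<open>The structure map \<open>\<alpha>\<close> is only relevant on \<open>A\<close>.\<close>

definition etale_algebra ::
  "'f::field set \<Rightarrow> ('f \<Rightarrow> 'r::{comm_ring,comm_monoid_mult}) \<Rightarrow> bool" where
  "etale_algebra A \<alpha> \<longleftrightarrow>
     unital_ring_hom_on A \<alpha> \<and>
     flat_algebra A \<alpha> \<and> finitely_presented_algebra A \<alpha> \<and> unramified_algebra A \<alpha>"

section \<open>Base change to \<open>R\<close>\<close>

text \<open>\<open>tK\<close> and \<open>tV\<close> are the pure tensors of \<open>K \<otimes>\<^sub>A R\<close> and \<open>V \<otimes>\<^sub>A R\<close>; the types of their values
  are \<open>'s\<close> (a ring) and \<open>'w\<close>.\<close>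

definition is_base_changed_algebra ::
  "'f::field set \<Rightarrow> ('f \<Rightarrow> 'k::ring_1) \<Rightarrow> ('f \<Rightarrow> 'r::{comm_ring,comm_monoid_mult}) \<Rightarrow>
     ('k \<Rightarrow> 'r \<Rightarrow> 's::{ring,monoid_mult}) \<Rightarrow> bool" where
  "is_base_changed_algebra A \<iota> \<alpha> tK \<longleftrightarrow>
     is_tensor_product A (\<lambda>a x. \<iota> a * x) (\<lambda>a r. \<alpha> a * r) tK \<and>
     tK 1 1 = 1 \<and> (\<forall>x r y s. tK x r * tK y s = tK (x * y) (r * s))"

definition is_base_changed_module ::
  "'f::field set \<Rightarrow> ('f \<Rightarrow> 'k::ring_1) \<Rightarrow> ('v::ab_group_add \<Rightarrow> 'k \<Rightarrow> 'v) \<Rightarrow>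
     ('f \<Rightarrow> 'r::{comm_ring,comm_monoid_mult}) \<Rightarrow> ('v \<Rightarrow> 'r \<Rightarrow> 'w::ab_group_add) \<Rightarrow> bool" where
  "is_base_changed_module A \<iota> act \<alpha> tV \<longleftrightarrow>
     is_tensor_product A (\<lambda>a x. act x (\<iota> a)) (\<lambda>a r. \<alpha> a * r) tV"

text \<open>As \<open>R\<close> is flat, \<open>M \<otimes> R\<close> is a subgroup of \<open>V \<otimes> R\<close> for every \<open>A\<close>-submodule \<open>M\<close> of \<open>V\<close>, and
  similarly \<open>B \<otimes> R\<close> is a subring of \<open>K \<otimes> R\<close>.\<close>

definition extend_lattice ::
  "('v \<Rightarrow> 'r \<Rightarrow> 'w::ab_group_add) \<Rightarrow> 'v set \<Rightarrow> 'w set" where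
  "extend_lattice t M = add_subgroup hull {t x r | x r. x \<in> M}"

definition extend_action ::
  "('k \<Rightarrow> 'r::times \<Rightarrow> 's::ab_group_add) \<Rightarrow> ('v \<Rightarrow> 'r \<Rightarrow> 'w::ab_group_add) \<Rightarrow> ('v \<Rightarrow> 'k \<Rightarrow> 'v) \<Rightarrow>
     'w \<Rightarrow> 's \<Rightarrow> 'w" where
  "extend_action tK tV act x s =
     tensor_lift tV (\<lambda>v r. tensor_lift tK (\<lambda>k r'. tV (act v k) (r * r')) s) x"

definition extend_involution ::
  "('k \<Rightarrow> 'r \<Rightarrow> 's::ab_group_add) \<Rightarrow> ('k \<Rightarrow> 'k) \<Rightarrow> 's \<Rightarrow> 's" where
  "extend_involution tK \<sigma> = tensor_lift tK (\<lambda>k r. tK (\<sigma> k) r)"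

definition extend_form ::
  "('k \<Rightarrow> 'r::times \<Rightarrow> 's::ab_group_add) \<Rightarrow> ('v \<Rightarrow> 'r \<Rightarrow> 'w::ab_group_add) \<Rightarrow> ('v \<Rightarrow> 'v \<Rightarrow> 'k) \<Rightarrow>
     'w \<Rightarrow> 'w \<Rightarrow> 's" where
  "extend_form tK tV h x y =
     tensor_lift tV (\<lambda>v r. tensor_lift tV (\<lambda>v' r'. tK (h v v') (r * r')) y) x"

text \<open>As 2 is invertible in \<open>K \<otimes> R\<close>, the extension of a quadratic form to \<open>V \<otimes> R\<close> is the diagonal
  of the extension of its associated bilinear form \<open>h\<close>.\<close>

definition extend_quadratic ::
  "('k \<Rightarrow> 'r::times \<Rightarrow> 's::ab_group_add) \<Rightarrow> ('v \<Rightarrow> 'r \<Rightarrow> 'w::ab_group_add) \<Rightarrow> ('v \<Rightarrow> 'v \<Rightarrow> 'k) \<Rightarrow>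
     'w \<Rightarrow> 's" where
  "extend_quadratic tK tV h x = extend_form tK tV h x x"

section \<open>The groups \<open>T\<^sup>m(R)\<close> and \<open>H\<^sup>0(R)\<close>\<close>

text \<open>Endomorphisms of, and forms on, \<open>L \<otimes> R\<close> are identified with their unique
  \<open>K \<otimes> R\<close>-(sesqui)linear extensions to \<open>V \<otimes> R\<close>. In the definitions below \<open>act\<close> is the action of
  \<open>K \<otimes> R\<close> on \<open>V \<otimes> R\<close>, \<open>M\<close> and \<open>M'\<close> stand for the images of \<open>L \<otimes> R\<close> and \<open>L\<^sup># \<otimes> R\<close> in \<open>V \<otimes> R\<close>,
  \<open>C\<close> for the image of \<open>B \<otimes> R\<close> in \<open>K \<otimes> R\<close>, and \<open>h\<close> for the extension of the
  hermitian form, or of the bilinear form associated with the quadratic form.\<close>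

definition T_zero ::
  "('w::ab_group_add \<Rightarrow> 's::{ring,monoid_mult} \<Rightarrow> 'w) \<Rightarrow> 'w set \<Rightarrow> 'w set \<Rightarrow> ('w \<Rightarrow> 'w) set" where
  "T_zero act M M' = {X. module_endo act X \<and> X ` M \<subseteq> M \<and> X ` M' \<subseteq> M'}"

definition is_adjoint ::
  "('w::ab_group_add \<Rightarrow> 's::{ring,monoid_mult} \<Rightarrow> 'w) \<Rightarrow> ('w \<Rightarrow> 'w \<Rightarrow> 's) \<Rightarrow> ('w \<Rightarrow> 'w) \<Rightarrow> ('w \<Rightarrow> 'w) \<Rightarrow> bool" where
  "is_adjoint act h X Y \<longleftrightarrow> module_endo act Y \<and> (\<forall>x y. h (X x) y = h x (Y y))"

definition adj ::
  "('w::ab_group_add \<Rightarrow> 's::{ring,monoid_mult} \<Rightarrow> 'w) \<Rightarrow> ('w \<Rightarrow> 'w \<Rightarrow> 's) \<Rightarrow> ('w \<Rightarrow> 'w) \<Rightarrow> ('w \<Rightarrow> 'w)" where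
  "adj act h X = (THE Y. is_adjoint act h X Y)"

definition H_zero_herm ::
  "('w::ab_group_add \<Rightarrow> 's::{ring,monoid_mult} \<Rightarrow> 'w) \<Rightarrow> ('s \<Rightarrow> 's) \<Rightarrow> 's \<Rightarrow> 's set \<Rightarrow> 'w set \<Rightarrow> 'w set \<Rightarrow>
     ('w \<Rightarrow> 'w \<Rightarrow> 's) set" where
  "H_zero_herm act \<sigma> \<epsilon> C M M' =
     {f. hermitian_form act \<sigma> \<epsilon> f \<and> (\<forall>x\<in>M. \<forall>y\<in>M. f x y \<in> C) \<and> (\<forall>x\<in>M. \<forall>y\<in>M'. f x y \<in> C)}"

definition H_zero_quad ::
  "('w::ab_group_add \<Rightarrow> 's::{ring,monoid_mult} \<Rightarrow> 'w) \<Rightarrow> 's \<Rightarrow> 's set \<Rightarrow> 'w set \<Rightarrow> 'w set \<Rightarrow>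
     ('w \<Rightarrow> 's) set" where
  "H_zero_quad act half C M M' =
     {f. quadratic_form act half f \<and> (\<forall>x\<in>M. f x \<in> C) \<and>
         (\<forall>x\<in>M. \<forall>y\<in>M'. assoc_bilinear half f x y \<in> C)}"

definition phi_herm :: "('w \<Rightarrow> 'w \<Rightarrow> 's) \<Rightarrow> ('w \<Rightarrow> 'w) \<Rightarrow> 'w \<Rightarrow> 'w \<Rightarrow> 's" where
  "phi_herm h X = (\<lambda>x y. h (X x) (X y))"

definition psi_herm :: "('w \<Rightarrow> 'w \<Rightarrow> 's::plus) \<Rightarrow> ('w \<Rightarrow> 'w) \<Rightarrow> 'w \<Rightarrow> 'w \<Rightarrow> 's" where
  "psi_herm h X = (\<lambda>x y. h x (X y) + h (X x) y)"

definition phi_quad :: "('w \<Rightarrow> 's) \<Rightarrow> ('w \<Rightarrow> 'w) \<Rightarrow> 'w \<Rightarrow> 's" where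
  "phi_quad q X = (\<lambda>x. q (X x))"

text \<open>The quadratic form whose associated bilinear form is \<open>h(x, X(y)) + h(X(x), y)\<close>.\<close>

definition psi_quad :: "('w \<Rightarrow> 'w \<Rightarrow> 's::plus) \<Rightarrow> ('w \<Rightarrow> 'w) \<Rightarrow> 'w \<Rightarrow> 's" where
  "psi_quad h X = (\<lambda>x. h x (X x) + h (X x) x)"

primrec T_filtration ::
  "('e \<Rightarrow> 'e) \<Rightarrow> ('e \<Rightarrow> 'h) \<Rightarrow> ('e \<Rightarrow> 'h) \<Rightarrow> 'e set \<Rightarrow> nat \<Rightarrow> 'e set" where
  "T_filtration ad \<phi> \<psi> T0 0 = T0"
| "T_filtration ad \<phi> \<psi> T0 (Suc m) =
     {X \<in> T_filtration ad \<phi> \<psi> T0 m.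
        \<phi> X \<in> \<psi> ` T_filtration ad \<phi> \<psi> T0 m \<and> \<phi> (ad X) \<in> \<psi> ` T_filtration ad \<phi> \<psi> T0 m}"

definition add_group :: "'a::ab_group_add set \<Rightarrow> 'a monoid" where
  "add_group H = \<lparr>carrier = H, mult = (+), one = 0\<rparr>"

end

theory Submission
  imports Defs
begin

text \<open>
  Since \<open>h(Xv, Yw) = h(v, X\<^sup>a\<^sup>d Y w)\<close>, one has \<open>\<phi>(X + Y) = \<phi>(X) + \<phi>(Y) + \<psi>(X\<^sup>a\<^sup>d Y)\<close>, and \<open>\<phi>(X) = \<psi>(Z)\<close>
  implies \<open>\<phi>(X Y) = \<psi>(Y\<^sup>a\<^sup>d Z Y)\<close>. By induction on \<open>m\<close>, \<open>T\<^sup>m\<close> is therefore stable under sums, adjoints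
  and products, and \<open>\<phi>\<close> is additive modulo \<open>\<psi>(T\<^sup>m)\<close>. For \<open>m = 0\<close> this requires that adjoints exist and
  preserve both lattices: nondegeneracy and reflexivity give a \<open>B\<close>-basis \<open>e\<^sub>i\<close> of \<open>L\<close> and a dual
  \<open>B\<close>-basis \<open>e'\<^sub>i\<close> of \<open>L\<^sup>#\<close>, which still exhibit \<open>L \<otimes> R\<close> and \<open>L\<^sup># \<otimes> R\<close> as duals of each other.
\<close>

section \<open>Additive maps and subgroups\<close>

text \<open>The two clauses of the recursion, on \<open>X\<close> and on its adjoint, have separate
  uses. Whether \<phi> of a product lies in the image of \<psi> is decided by its left factor, and
  the adjoint of \<open>X \<circ> Y\<close> has the adjoint of \<open>Y\<close> as left factor.
  Sums, adjoints and products have to go through one induction, because the error term of a sum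
  involves the product of an adjoint with an endomorphism.

  The hermitian and the quadratic case share this argument, so it is run with forms replaced by
  elements of an arbitrary abelian group. The cases differ mainly in integrality: if 2 is not a
  unit, the bilinear form \<open>h\<close> of an integral quadratic form need not be integral on
  \<open>L\<close>; only its diagonal and \<open>2h\<close> are. Everything about adjoints is
  therefore arranged to use the pairing between \<open>L\<close> and its dual, which is integral in
  both cases. In one of the two orders of arguments this integrality comes from reflexivity and not
  from the symmetry of \<open>h\<close>, because stability of \<open>B\<close> under \<sigma> is
  itself a consequence of it.

  Tensor products are given by generators and relations, so identities in them are checked on pure
  tensors, one variable at a time.\<close>

lemma add_subgroupD:
  assumes "add_subgroup H"
  shows "0 \<in> H" "x \<in> H \<Longrightarrow> y \<in> H \<Longrightarrow> x - y \<in> H" "x \<in> H \<Longrightarrow> - x \<in> H"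
    "x \<in> H \<Longrightarrow> y \<in> H \<Longrightarrow> x + y \<in> H"
proof -
  show 0: "0 \<in> H" and diff: "x \<in> H \<Longrightarrow> y \<in> H \<Longrightarrow> x - y \<in> H" for x y
    using assms by (auto simp: add_subgroup_def)
  show minus: "x \<in> H \<Longrightarrow> - x \<in> H" for x
    using diff[OF 0, of x] by simp
  show "x \<in> H \<Longrightarrow> y \<in> H \<Longrightarrow> x + y \<in> H"
    using diff[OF _ minus, of x y] by simp
qed

lemma add_subgroupI:
  assumes "0 \<in> H" "\<And>x y. x \<in> H \<Longrightarrow> y \<in> H \<Longrightarrow> x + y \<in> H" "\<And>x. x \<in> H \<Longrightarrow> - x \<in> H"
  shows "add_subgroup H"
  unfolding add_subgroup_def
  using assms(1) assms(2)[OF _ assms(3)] by auto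

lemma add_subgroup_sum:
  assumes "add_subgroup H" "\<And>i. i \<in> I \<Longrightarrow> f i \<in> H"
  shows "(\<Sum>i\<in>I. f i) \<in> H"
  using assms(2) by (induction I rule: infinite_finite_induct) (auto intro: add_subgroupD[OF assms(1)])

lemma add_subgroup_hull: "add_subgroup (add_subgroup hull S)"
  by (rule hull_in) (auto simp: add_subgroup_def)

lemma add_subgroup_hull_subset: "add_subgroup H \<Longrightarrow> S \<subseteq> H \<Longrightarrow> add_subgroup hull S \<subseteq> H"
  by (rule hull_minimal)

lemma add_subgroup_vimage:
  assumes "additive f" "add_subgroup H"
  shows "add_subgroup {x. f x \<in> H}"
  using add_subgroupD[OF assms(2)] 
  by (auto simp: add_subgroup_def additive.zero[OF assms(1)] additive.diff[OF assms(1)])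

lemma additive_compose: "additive f \<Longrightarrow> additive g \<Longrightarrow> additive (\<lambda>x. f (g x))"
  by (simp add: additive_def)

lemma additive_plus: "additive f \<Longrightarrow> additive g \<Longrightarrow> additive (\<lambda>x. f x + g x :: 'a::ab_group_add)"
  by (simp add: additive_def algebra_simps)

lemma additive_sum_map:
  "(\<And>i. i \<in> I \<Longrightarrow> additive (f i)) \<Longrightarrow> additive (\<lambda>x. \<Sum>i\<in>I. f i x :: 'a::ab_group_add)"
  by (simp add: additive_def sum.distrib)

lemma additive_mult_left: "additive (\<lambda>x. c * x :: 'a::ring)"
  by (simp add: additive_def distrib_left)

lemma additive_mult_right: "additive (\<lambda>x. x * c :: 'a::ring)"
  by (simp add: additive_def distrib_right)

lemma biadditiveI:
  assumes "\<And>x x' y. f (x + x') y = f x y + f x' y" "\<And>x y y'. f x (y + y') = f x y + f x y'"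
  shows "biadditive f"
  using assms by (simp add: biadditive_def additive_def)

lemma biadditiveD:
  assumes "biadditive f"
  shows "additive (f x)" "additive (\<lambda>x. f x y)"
  using assms by (simp_all add: biadditive_def)

lemma biadditive_simps:
  assumes "biadditive f"
  shows "f (x + x') y = f x y + f x' y" "f x (y + y') = f x y + f x y'"
    "f 0 y = 0" "f x 0 = 0" "f (- x) y = - f x y" "f x (- y) = - f x y"
    "f (x - x') y = f x y - f x' y" "f x (y - y') = f x y - f x y'"
    "f (\<Sum>i\<in>I. u i) y = (\<Sum>i\<in>I. f (u i) y)" "f x (\<Sum>i\<in>I. w i) = (\<Sum>i\<in>I. f x (w i))"
  using additive.add[OF biadditiveD(1)[OF assms]] additive.add[OF biadditiveD(2)[OF assms]]
    additive.zero[OF biadditiveD(1)[OF assms]] additive.zero[OF biadditiveD(2)[OF assms]]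
    additive.minus[OF biadditiveD(1)[OF assms]] additive.minus[OF biadditiveD(2)[OF assms]]
    additive.diff[OF biadditiveD(1)[OF assms]] additive.diff[OF biadditiveD(2)[OF assms]]
    additive.sum[OF biadditiveD(1)[OF assms]] additive.sum[OF biadditiveD(2)[OF assms]]
  by simp_all

section \<open>The universal property of tensor products\<close>

text \<open>This is the action of the integers on an abelian group. Since \<open>nat\<close> sends
  negative integers to 0, at most one of the two sums is nonempty.\<close>

definition int_multiple :: "int \<Rightarrow> 'a::ab_group_add \<Rightarrow> 'a" where
  "int_multiple k x = (\<Sum>i<nat k. x) - (\<Sum>i<nat (- k). x)"

lemma sum_const_add: "(\<Sum>i<m + n. x) = (\<Sum>i<m. x) + (\<Sum>i<(n::nat). x::'a::ab_group_add)"
  by (induction n) (simp_all add: add_ac)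

text \<open>Every representation of an integer as a difference of naturals may be used to compute
  the multiple. Additivity in \<open>k\<close> then becomes a rearrangement of sums, with no
  distinction of signs.\<close>

lemma int_multiple_diff_nat:
  "int_multiple (int a - int b) x = (\<Sum>i<a. x) - (\<Sum>i<b. x)"
proof (cases "a \<le> b")
  case True
  then have "(\<Sum>i<b. x) = (\<Sum>i<b - a. x) + (\<Sum>i<a. x)"
    using sum_const_add[of x "b - a" a] by simp
  then show ?thesis
    using True by (simp add: int_multiple_def nat_diff_distrib' of_nat_diff[symmetric] del: of_nat_diff)
next
  case False
  then have "(\<Sum>i<a. x) = (\<Sum>i<a - b. x) + (\<Sum>i<b. x)"
    using sum_const_add[of x "a - b" b] by simp
  then show ?thesis
    using False by (simp add: int_multiple_def nat_diff_distrib' of_nat_diff[symmetric] del: of_nat_diff)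
qed

lemma int_multiple_add: "int_multiple (k + l) x = int_multiple k x + int_multiple l x"
proof -
  obtain a b c d where "k = int a - int b" and "l = int c - int d"
    by (metis int_diff_cases)
  moreover from this have "k + l = int (a + c) - int (b + d)"
    by simp
  ultimately show ?thesis
    by (simp only: int_multiple_diff_nat sum_const_add) simp
qed

lemma int_multiple_0 [simp]: "int_multiple 0 x = 0" and int_multiple_1 [simp]: "int_multiple 1 x = x"
  by (simp_all add: int_multiple_def)

text \<open>The homomorphism from the free abelian group on \<open>'p\<close> that extends
  \<open>g\<close>.\<close>

definition frag_eval :: "('p \<Rightarrow> 'g::ab_group_add) \<Rightarrow> ('p \<Rightarrow>\<^sub>0 int) \<Rightarrow> 'g" where
  "frag_eval g z = (\<Sum>p\<in>Poly_Mapping.keys z. int_multiple (Poly_Mapping.lookup z p) (g p))"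

lemma frag_eval_superset:
  assumes "finite S" "Poly_Mapping.keys z \<subseteq> S"
  shows "frag_eval g z = (\<Sum>p\<in>S. int_multiple (Poly_Mapping.lookup z p) (g p))"
  unfolding frag_eval_def using assms
  by (intro sum.mono_neutral_left) (auto simp: in_keys_iff)

lemma additive_frag_eval: "additive (frag_eval g)"
proof
  fix y z :: "'a \<Rightarrow>\<^sub>0 int"
  let ?S = "Poly_Mapping.keys y \<union> Poly_Mapping.keys z"
  have "Poly_Mapping.keys (y + z) \<subseteq> ?S"
    by (rule Poly_Mapping.keys_add)
  then show "frag_eval g (y + z) = frag_eval g y + frag_eval g z"
    by (simp add: frag_eval_superset[of ?S] lookup_add int_multiple_add sum.distrib)
qed

lemma frag_eval_frag_of [simp]: "frag_eval g (frag_of p) = g p"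
  by (simp add: frag_eval_def)

locale tensor_product =
  fixes A :: "'a set" and sm :: "'a \<Rightarrow> 'm::ab_group_add \<Rightarrow> 'm" and sn :: "'a \<Rightarrow> 'n::ab_group_add \<Rightarrow> 'n"
    and t :: "'m::ab_group_add \<Rightarrow> 'n::ab_group_add \<Rightarrow> 't::ab_group_add"
  assumes tensor: "is_tensor_product A sm sn t"
begin

lemma presentation:
  obtains \<pi> where "additive \<pi>" "surj \<pi>" "\<And>x y. \<pi> (frag_of (x, y)) = t x y"
    "\<And>z. \<pi> z = 0 \<longleftrightarrow> z \<in> tensor_relations A UNIV sm UNIV sn"
  using tensor unfolding is_tensor_product_def by blast

text \<open>The first two families of generators of \<open>tensor_relations\<close> lie in the
  kernel of the presentation, and their vanishing is biadditivity.\<close>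

lemma biadditive_pure: "biadditive t"
proof -
  obtain \<pi> where \<pi>: "additive \<pi>" "\<And>x y. \<pi> (frag_of (x, y)) = t x y"
    "\<And>z. \<pi> z = 0 \<longleftrightarrow> z \<in> tensor_relations A UNIV sm UNIV sn"
    by (rule presentation) blast
  have gen: "\<pi> z = 0" if "z \<in>
     {frag_of (x + x', y) - frag_of (x, y) - frag_of (x', y) | x x' y. x \<in> UNIV \<and> x' \<in> UNIV \<and> y \<in> UNIV} \<union>
      {frag_of (x, y + y') - frag_of (x, y) - frag_of (x, y') | x y y'. x \<in> UNIV \<and> y \<in> UNIV \<and> y' \<in> UNIV}" for z
    unfolding \<pi>(3) tensor_relations_def by (rule hull_inc) (use that in blast)
  show ?thesis
  proof (rule biadditiveI)
    fix x x' y
    have "\<pi> (frag_of (x + x', y) - frag_of (x, y) - frag_of (x', y)) = 0"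
      by (rule gen) blast
    then show "t (x + x') y = t x y + t x' y"
      by (simp add: additive.diff[OF \<pi>(1)] \<pi>(2) diff_eq_eq)
  next
    fix x y y'
    have "\<pi> (frag_of (x, y + y') - frag_of (x, y) - frag_of (x, y')) = 0"
      by (rule gen) blast
    then show "t x (y + y') = t x y + t x y'"
      by (simp add: additive.diff[OF \<pi>(1)] \<pi>(2) diff_eq_eq)
  qed
qed

lemma pure_balanced: "a \<in> A \<Longrightarrow> t (sm a x) y = t x (sn a y)"
proof -
  assume a: "a \<in> A"
  obtain \<pi> where \<pi>: "additive \<pi>" "\<And>x y. \<pi> (frag_of (x, y)) = t x y"
    "\<And>z. \<pi> z = 0 \<longleftrightarrow> z \<in> tensor_relations A UNIV sm UNIV sn"
    by (rule presentation) blast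
  have "\<pi> (frag_of (sm a x, y) - frag_of (x, sn a y)) = 0"
    unfolding \<pi>(3) tensor_relations_def by (rule hull_inc) (use a in blast)
  then show ?thesis
    by (simp add: additive.diff[OF \<pi>(1)] \<pi>(2))
qed

text \<open>The presentation is surjective, so pure tensors generate. All later identities on tensor
  products are reduced to pure tensors by this.\<close>

lemma subgroup_UNIV:
  assumes "add_subgroup H" "\<And>x y. t x y \<in> H"
  shows "w \<in> H"
proof -
  obtain \<pi> where \<pi>: "additive \<pi>" "surj \<pi>" "\<And>x y. \<pi> (frag_of (x, y)) = t x y"
    by (rule presentation) blast
  obtain z where z: "w = \<pi> z"
    using \<pi>(2) by (metis surjD)
  have "Poly_Mapping.keys z \<subseteq> UNIV" by simp
  then have "\<pi> z \<in> H"
  proof (induction z rule: frag_induction)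
    case zero
    then show ?case using \<pi>(1) assms(1) by (simp add: additive.zero add_subgroupD)
  next
    case (one p)
    then show ?case using \<pi>(3) assms(2) by (cases p) simp
  next
    case (diff a b)
    then show ?case using \<pi>(1) assms(1) by (simp add: additive.diff add_subgroupD)
  qed
  then show ?thesis by (simp add: z)
qed

lemma additive_eqI:
  assumes "additive f" "additive g" "\<And>x y. f (t x y) = g (t x y)"
  shows "f w = g w"
proof -
  have "add_subgroup {w. f w = g w}"
    by (auto simp: add_subgroup_def additive.zero[OF assms(1)] additive.zero[OF assms(2)]
        additive.diff[OF assms(1)] additive.diff[OF assms(2)])
  then show ?thesis
    using subgroup_UNIV[of "{w. f w = g w}" w] assms(3) by simp
qed

text \<open>The extension of \<open>g\<close> to the free abelian group kills the tensor relations
  and hence factors through the presentation. As pure tensors generate, the factor is unique, which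
  gives the definite description its meaning.\<close>

lemma tensor_lift:
  fixes g :: "'m \<Rightarrow> 'n \<Rightarrow> 'g::ab_group_add"
  assumes g: "biadditive g" and bal: "\<And>a x y. a \<in> A \<Longrightarrow> g (sm a x) y = g x (sn a y)"
  shows "additive (tensor_lift t g)" "tensor_lift t g (t x y) = g x y"
proof -
  obtain \<pi> where \<pi>: "additive \<pi>" "surj \<pi>" "\<And>x y. \<pi> (frag_of (x, y)) = t x y"
    "\<And>z. \<pi> z = 0 \<longleftrightarrow> z \<in> tensor_relations A UNIV sm UNIV sn"
    by (rule presentation) blast
  let ?e = "frag_eval (\<lambda>(x, y). g x y)"
  have e_diff: "?e (u - v) = ?e u - ?e v" for u v
    by (rule additive.diff[OF additive_frag_eval])
  have "add_subgroup {z. ?e z \<in> {0}}"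
    by (intro add_subgroup_vimage additive_frag_eval) (simp add: add_subgroup_def)
  then have "tensor_relations A UNIV sm UNIV sn \<subseteq> {z. ?e z \<in> {0}}"
    unfolding tensor_relations_def
    by (rule add_subgroup_hull_subset) (auto simp: e_diff biadditive_simps[OF g] bal)
  then have ker: "?e z = 0" if "\<pi> z = 0" for z
    using that \<pi>(4) by auto
  have wd: "?e u = ?e v" if "\<pi> u = \<pi> v" for u v
    using ker[of "u - v"] that by (simp add: e_diff additive.diff[OF \<pi>(1)])
  \<comment> \<open>Some preimage under \<pi> is chosen; by \<open>wd\<close> the value does not
    depend on it.\<close>
  define G where "G w = ?e (SOME z. \<pi> z = w)" for w
  have G: "G (\<pi> z) = ?e z" for z
    unfolding G_def by (rule wd) (rule someI[of _ z], simp)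
  have "additive G"
  proof
    fix u v
    obtain y z where "u = \<pi> y" "v = \<pi> z"
      using \<pi>(2) by (metis surjD)
    then show "G (u + v) = G u + G v"
      by (simp add: additive.add[OF \<pi>(1), symmetric] G additive.add[OF additive_frag_eval])
  qed
  moreover have "G (t x y) = g x y" for x y
    using G[of "frag_of (x, y)"] by (simp add: \<pi>(3))
  moreover have "G' = G" if "additive G'" "\<forall>x y. G' (t x y) = g x y" for G'
    using additive_eqI[OF that(1) calculation(1)] that(2) calculation(2) by auto
  ultimately have "tensor_lift t g = G"
    unfolding tensor_lift_def by (intro the_equality) blast+
  then show "additive (tensor_lift t g)" "tensor_lift t g (t x y) = g x y"
    using \<open>additive G\<close> \<open>\<And>x y. G (t x y) = g x y\<close> by simp_all
qed

end

section \<open>The abstract filtration\<close>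

text \<open>These are the properties on which the induction on \<open>m\<close> runs. Forms are
  elements of an abstract group \<open>'h\<close>, so that two-variable hermitian forms and
  one-variable quadratic forms are both instances. Pulling a form back along \<open>Y\<close> makes
  no sense in \<open>'h\<close>, which is why \<open>\<phi>_comp\<close> is an implication between
  equations.\<close>

locale form_filtration =
  fixes ad :: "('w::ab_group_add \<Rightarrow> 'w) \<Rightarrow> 'w \<Rightarrow> 'w"
    and \<phi> \<psi> :: "('w \<Rightarrow> 'w) \<Rightarrow> 'h::ab_group_add"
    and T0 :: "('w \<Rightarrow> 'w) set" and H0 :: "'h set"
  assumes T0_subgroup: "add_subgroup T0" and H0_subgroup: "add_subgroup H0"
    and comp_closed: "X \<in> T0 \<Longrightarrow> Y \<in> T0 \<Longrightarrow> X \<circ> Y \<in> T0"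
    and ad_closed: "X \<in> T0 \<Longrightarrow> ad X \<in> T0"
    and ad_ad: "X \<in> T0 \<Longrightarrow> ad (ad X) = X"
    and ad_add: "X \<in> T0 \<Longrightarrow> Y \<in> T0 \<Longrightarrow> ad (X + Y) = ad X + ad Y"
    and ad_comp: "X \<in> T0 \<Longrightarrow> Y \<in> T0 \<Longrightarrow> ad (X \<circ> Y) = ad Y \<circ> ad X"
    and \<phi>_closed: "X \<in> T0 \<Longrightarrow> \<phi> X \<in> H0"
    and \<psi>_closed: "X \<in> T0 \<Longrightarrow> \<psi> X \<in> H0"
    and \<psi>_add: "X \<in> T0 \<Longrightarrow> Y \<in> T0 \<Longrightarrow> \<psi> (X + Y) = \<psi> X + \<psi> Y"
    and \<phi>_add: "X \<in> T0 \<Longrightarrow> Y \<in> T0 \<Longrightarrow> \<phi> (X + Y) = \<phi> X + \<phi> Y + \<psi> (ad X \<circ> Y)"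
    and \<phi>_uminus: "X \<in> T0 \<Longrightarrow> \<phi> (- X) = \<phi> X"
    and \<phi>_comp: "X \<in> T0 \<Longrightarrow> Y \<in> T0 \<Longrightarrow> Z \<in> T0 \<Longrightarrow> \<phi> X = \<psi> Z \<Longrightarrow> \<phi> (X \<circ> Y) = \<psi> (ad Y \<circ> Z \<circ> Y)"
begin

abbreviation T :: "nat \<Rightarrow> ('w \<Rightarrow> 'w) set" where
  "T \<equiv> T_filtration ad \<phi> \<psi> T0"

lemma T_subset: "T m \<subseteq> T0"
  by (induction m) auto

lemma ad_zero: "ad 0 = 0"
  using ad_add[of 0 0] add_subgroupD(1)[OF T0_subgroup] by simp

lemma ad_uminus: "X \<in> T0 \<Longrightarrow> ad (- X) = - ad X"
  using ad_add[of X "- X"] add_subgroupD(3)[OF T0_subgroup, of X]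
  by (simp add: ad_zero eq_neg_iff_add_eq_0 add.commute)

lemma \<psi>_zero: "\<psi> 0 = 0"
  using \<psi>_add[of 0 0] add_subgroupD(1)[OF T0_subgroup] by simp

lemma \<psi>_uminus: "X \<in> T0 \<Longrightarrow> \<psi> (- X) = - \<psi> X"
  using \<psi>_add[of X "- X"] add_subgroupD(3)[OF T0_subgroup, of X]
  by (simp add: \<psi>_zero eq_neg_iff_add_eq_0 add.commute)

lemma \<phi>_zero: "\<phi> 0 = 0"
proof -
  have "ad 0 \<circ> 0 = (0 :: 'w \<Rightarrow> 'w)"
    by (auto simp: ad_zero)
  then show ?thesis
    using \<phi>_add[of 0 0] add_subgroupD(1)[OF T0_subgroup] by (simp add: \<psi>_zero)
qed

text \<open>The three closure properties feed each other: at level \<open>Suc m\<close>, a sum needs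
  \<open>ad X \<circ> Y\<close> in \<open>T m\<close>, and a product needs
  \<open>ad Y \<circ> Z \<circ> Y\<close> in \<open>T m\<close>.\<close>

lemma T_invariants:
  "add_subgroup (T m) \<and> (\<forall>X\<in>T m. ad X \<in> T m) \<and> (\<forall>X\<in>T m. \<forall>Y\<in>T m. X \<circ> Y \<in> T m)"
proof (induction m)
  case 0
  then show ?case
    unfolding T_filtration.simps using T0_subgroup ad_closed comp_closed by blast
next
  case (Suc m)
  have sub: "add_subgroup (T m)" and ad: "\<And>X. X \<in> T m \<Longrightarrow> ad X \<in> T m"
    and comp: "\<And>X Y. X \<in> T m \<Longrightarrow> Y \<in> T m \<Longrightarrow> X \<circ> Y \<in> T m"
    using Suc by blast+
  note T0 = subsetD[OF T_subset[of m]]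
  note T = add_subgroupD[OF sub]
  have mem: "X \<in> T (Suc m) \<longleftrightarrow> X \<in> T m \<and> \<phi> X \<in> \<psi> ` T m \<and> \<phi> (ad X) \<in> \<psi> ` T m" for X
    by simp
  \<comment> \<open>The two clauses of the recursion are exchanged by the involution
    \<open>ad\<close>.\<close>
  have adT: "ad X \<in> T (Suc m)" if "X \<in> T (Suc m)" for X
    using that ad ad_ad T0 unfolding mem by metis
  have \<phi>_plus: "\<phi> (X + Y) \<in> \<psi> ` T m"
    if XY: "X \<in> T m" "Y \<in> T m" and \<phi>: "\<phi> X \<in> \<psi> ` T m" "\<phi> Y \<in> \<psi> ` T m" for X Y
  proof -
    obtain U V where UV: "U \<in> T m" "V \<in> T m" "\<phi> X = \<psi> U" "\<phi> Y = \<psi> V"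
      using \<phi> by blast
    have C: "ad X \<circ> Y \<in> T m"
      using XY by (intro comp ad)
    have "\<phi> (X + Y) = \<psi> (U + V + (ad X \<circ> Y))"
      using XY UV C by (simp add: \<phi>_add \<psi>_add T0 T del: comp_apply)
    then show ?thesis
      using UV C T(4) by blast
  qed
  have \<phi>_circ: "\<phi> (X \<circ> Y) \<in> \<psi> ` T m"
    if XY: "X \<in> T m" "Y \<in> T m" and \<phi>: "\<phi> X \<in> \<psi> ` T m" for X Y
  proof -
    obtain Z where Z: "Z \<in> T m" "\<phi> X = \<psi> Z"
      using \<phi> by blast
    then have "\<phi> (X \<circ> Y) = \<psi> (ad Y \<circ> Z \<circ> Y)"
      using XY by (intro \<phi>_comp T0)
    moreover have "ad Y \<circ> Z \<circ> Y \<in> T m"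
      using XY Z by (intro comp ad)
    ultimately show ?thesis
      by blast
  qed
  have "add_subgroup (T (Suc m))"
  proof (rule add_subgroupI)
    have "\<phi> 0 \<in> \<psi> ` T m"
      using T(1) \<phi>_zero \<psi>_zero by (metis imageI)
    then show "0 \<in> T (Suc m)"
      unfolding mem using T(1) ad_zero by metis
    show "X + Y \<in> T (Suc m)" if "X \<in> T (Suc m)" "Y \<in> T (Suc m)" for X Y
      using that unfolding mem by (metis T(4) T0 ad ad_add \<phi>_plus)
    show "- X \<in> T (Suc m)" if "X \<in> T (Suc m)" for X
      using that unfolding mem by (metis T(3) T0 ad ad_uminus \<phi>_uminus)
  qed
  \<comment> \<open>The clause on the adjoint is \<open>\<phi>_circ\<close> for
    \<open>ad Y \<circ> ad X\<close>; its left factor is \<open>ad Y\<close>, so it is the second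
    clause for \<open>Y\<close> that is used.\<close>
  moreover have "X \<circ> Y \<in> T (Suc m)" if "X \<in> T (Suc m)" "Y \<in> T (Suc m)" for X Y
    using that unfolding mem by (metis T0 ad ad_comp comp \<phi>_circ)
  ultimately show ?case
    using adT by blast
qed

lemma T_subgroup: "add_subgroup (T m)"
  using T_invariants by blast

lemma ad_T: "X \<in> T m \<Longrightarrow> ad X \<in> T m"
  using T_invariants by blast

lemma comp_T: "X \<in> T m \<Longrightarrow> Y \<in> T m \<Longrightarrow> X \<circ> Y \<in> T m"
  using T_invariants by blast

end

section \<open>Groups, quotients and homomorphisms attached to additive subgroups\<close>

lemma comm_group_add_group:
  assumes "add_subgroup H"
  shows "comm_group (add_group H)"
proof (rule comm_groupI)
  fix x assume "x \<in> carrier (add_group H)"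
  then show "\<exists>y\<in>carrier (add_group H). y \<otimes>\<^bsub>add_group H\<^esub> x = \<one>\<^bsub>add_group H\<^esub>"
    using add_subgroupD(3)[OF assms, of x] by (auto simp: add_group_def intro!: bexI[of _ "- x"])
qed (auto simp: add_group_def add_subgroupD[OF assms] add.assoc add.commute)

lemma normal_add_group:
  assumes H: "add_subgroup H" and N: "add_subgroup N" "N \<subseteq> H"
  shows "N \<lhd> add_group H"
proof (rule comm_group.subgroup_imp_normal[OF comm_group_add_group[OF H]])
  interpret H: comm_group "add_group H"
    by (rule comm_group_add_group[OF H])
  have inv: "inv\<^bsub>add_group H\<^esub> x = - x" if "x \<in> N" for x
    using that N add_subgroupD(3)[OF H, of x] by (intro H.inv_equality) (auto simp: add_group_def)
  show "subgroup N (add_group H)"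
      proof (rule H.subgroupI)
    show "inv\<^bsub>add_group H\<^esub> x \<in> N" if "x \<in> N" for x
      using that add_subgroupD(3)[OF N(1)] by (simp add: inv)
  qed (use N add_subgroupD[OF N(1)] in \<open>auto simp: add_group_def\<close>)
qed

text \<open>The coset of \<open>N\<close> absorbs the error \<open>u\<close>, so additivity up to
  \<open>N\<close> is enough. The error stands on the left to match right cosets.\<close>

lemma hom_quotient_add_group:
  assumes H: "add_subgroup H" and N: "add_subgroup N" "N \<subseteq> H"
    and \<phi>: "\<And>x. x \<in> G \<Longrightarrow> \<phi> x \<in> H"
    and add: "\<And>x y. x \<in> G \<Longrightarrow> y \<in> G \<Longrightarrow> \<exists>u\<in>N. \<phi> (x + y) = u + (\<phi> x + \<phi> y)"
  shows "(\<lambda>x. N #>\<^bsub>add_group H\<^esub> \<phi> x) \<in> hom (add_group G) (add_group H Mod N)"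
proof (rule homI)
  interpret N: normal N "add_group H"
    by (rule normal_add_group[OF H N])
  fix x assume x: "x \<in> carrier (add_group G)"
  then have \<phi>x: "\<phi> x \<in> carrier (add_group H)"
    using \<phi> by (simp add: add_group_def)
  then show "N #>\<^bsub>add_group H\<^esub> \<phi> x \<in> carrier (add_group H Mod N)"
    by (auto simp: FactGroup_def RCOSETS_def)
  fix y assume y: "y \<in> carrier (add_group G)"
  then have \<phi>y: "\<phi> y \<in> carrier (add_group H)"
    using \<phi> by (simp add: add_group_def)
  obtain u where u: "u \<in> N" "\<phi> (x + y) = u + (\<phi> x + \<phi> y)"
    using add x y by (auto simp: add_group_def)
  have "N #>\<^bsub>add_group H\<^esub> \<phi> (x + y) = N #>\<^bsub>add_group H\<^esub> (u \<otimes>\<^bsub>add_group H\<^esub> (\<phi> x \<otimes>\<^bsub>add_group H\<^esub> \<phi> y))"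
    by (simp add: u add_group_def)
  also have "\<dots> = N #>\<^bsub>add_group H\<^esub> (\<phi> x \<otimes>\<^bsub>add_group H\<^esub> \<phi> y)"
  proof -
    have "N #>\<^bsub>add_group H\<^esub> u = N"
      using u(1) by (intro N.coset_join2 N.mem_carrier N.subgroup_axioms)
    then show ?thesis
      using \<phi>x \<phi>y u(1) N.coset_mult_assoc[OF N.subset N.mem_carrier[OF u(1)], of "\<phi> x \<otimes>\<^bsub>add_group H\<^esub> \<phi> y"]
      by simp
  qed
  also have "\<dots> = (N #>\<^bsub>add_group H\<^esub> \<phi> x) \<otimes>\<^bsub>add_group H Mod N\<^esub> (N #>\<^bsub>add_group H\<^esub> \<phi> y)"
    using \<phi>x \<phi>y by (simp add: FactGroup_def N.rcos_sum)
  finally show "N #>\<^bsub>add_group H\<^esub> \<phi> (x \<otimes>\<^bsub>add_group G\<^esub> y) =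
      (N #>\<^bsub>add_group H\<^esub> \<phi> x) \<otimes>\<^bsub>add_group H Mod N\<^esub> (N #>\<^bsub>add_group H\<^esub> \<phi> y)"
    by (simp add: add_group_def)
qed

context form_filtration
begin

lemma \<psi>_image_subgroup: "add_subgroup (\<psi> ` T m)"
proof (rule add_subgroupI)
  note T0 = subsetD[OF T_subset[of m]]
  note T = add_subgroupD[OF T_subgroup[of m]]
  show "0 \<in> \<psi> ` T m"
    using T(1) \<psi>_zero by (metis imageI)
  show "x + y \<in> \<psi> ` T m" if xy: "x \<in> \<psi> ` T m" "y \<in> \<psi> ` T m" for x y
  proof -
    obtain X Y where "X \<in> T m" "Y \<in> T m" "x = \<psi> X" "y = \<psi> Y"
      using xy by blast
    then have "x + y = \<psi> (X + Y)" "X + Y \<in> T m"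
      by (simp_all add: \<psi>_add T0 T(4))
    then show ?thesis
      by blast
  qed
  show "- x \<in> \<psi> ` T m" if x: "x \<in> \<psi> ` T m" for x
  proof -
    obtain X where "X \<in> T m" "x = \<psi> X"
      using x by blast
    then have "- x = \<psi> (- X)" "- X \<in> T m"
      by (simp_all add: \<psi>_uminus T0 T(3))
    then show ?thesis
      by blast
  qed
qed

lemma \<psi>_image_subset: "\<psi> ` T m \<subseteq> H0"
  using T_subset \<psi>_closed by blast

text \<open>The failure of \<phi> to be additive is \<open>\<psi> (ad X \<circ> Y)\<close>, which
  stays in the image of \<open>T m\<close> since \<open>T m\<close> is stable under adjoints and
  products. Normality of that image is included because it makes the factor group
  meaningful.\<close>

theorem filtration_homs:
  "\<psi> ` T m \<lhd> add_group H0 \<and>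
   group (add_group (T m)) \<and> group (add_group (T (Suc m))) \<and>
   (\<forall>X\<in>T m. \<forall>Y\<in>T m. ad X \<circ> Y \<in> T m) \<and>
   \<psi> \<in> hom (add_group (T m)) (add_group H0) \<and>
   (\<lambda>X. (\<psi> ` T m) #>\<^bsub>add_group H0\<^esub> \<phi> X) \<in> hom (add_group (T m)) (add_group H0 Mod (\<psi> ` T m))"
proof (intro conjI ballI)
  note T0 = subsetD[OF T_subset[of m]]
  show "\<psi> ` T m \<lhd> add_group H0"
    by (intro normal_add_group H0_subgroup \<psi>_image_subgroup \<psi>_image_subset)
  show "group (add_group (T m))" "group (add_group (T (Suc m)))"
    by (intro comm_group.axioms(2) comm_group_add_group T_subgroup)+
  show "ad X \<circ> Y \<in> T m" if "X \<in> T m" "Y \<in> T m" for X Y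
    using that by (intro comp_T ad_T)
  show "\<psi> \<in> hom (add_group (T m)) (add_group H0)"
    by (rule homI) (simp_all add: add_group_def \<psi>_closed \<psi>_add T0)
  show "(\<lambda>X. (\<psi> ` T m) #>\<^bsub>add_group H0\<^esub> \<phi> X) \<in> hom (add_group (T m)) (add_group H0 Mod (\<psi> ` T m))"
  proof (rule hom_quotient_add_group[OF H0_subgroup \<psi>_image_subgroup \<psi>_image_subset])
    show "\<exists>u\<in>\<psi> ` T m. \<phi> (X + Y) = u + (\<phi> X + \<phi> Y)" if "X \<in> T m" "Y \<in> T m" for X Y
          proof
      show "\<phi> (X + Y) = \<psi> (ad X \<circ> Y) + (\<phi> X + \<phi> Y)"
        using that \<phi>_add T0 by (metis add.commute)
      show "\<psi> (ad X \<circ> Y) \<in> \<psi> ` T m"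
        using that by (intro imageI comp_T ad_T)
    qed
  qed (simp add: \<phi>_closed T0)
qed

end

section \<open>Dual bases of a reflexive lattice\<close>

text \<open>\<open>A_inverse\<close> says that \<open>A\<close> is a valuation ring of
  \<open>F\<close>, and at 1 it yields \<open>1 \<in> A\<close>. Integrality of \<open>h\<close> on
  \<open>L\<close> is left to the two cases, since for quadratic forms it holds only for the
  diagonal and for \<open>2h\<close>.\<close>

locale hermitian_lattice =
  fixes A :: "'f::field set" and \<iota> :: "'f \<Rightarrow> 'k::ring_1" and \<sigma> :: "'k \<Rightarrow> 'k" and \<epsilon> :: 'k
    and B :: "'k set" and act :: "'v::ab_group_add \<Rightarrow> 'k \<Rightarrow> 'v" and L :: "'v set" and n :: nat
    and h :: "'v \<Rightarrow> 'v \<Rightarrow> 'k"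
  assumes A_mult: "a \<in> A \<Longrightarrow> b \<in> A \<Longrightarrow> a * b \<in> A"
    and A_inverse: "a \<noteq> 0 \<Longrightarrow> a \<in> A \<or> inverse a \<in> A"
    and \<iota>_hom: "unital_ring_hom_on UNIV \<iota>"
    and \<iota>_central: "range \<iota> \<subseteq> ring_center"
    and \<sigma>_additive: "additive \<sigma>"
    and \<sigma>_mult: "\<sigma> (x * y) = \<sigma> y * \<sigma> x"
    and \<sigma>_\<iota>: "\<sigma> (\<iota> a) = \<iota> a"
    and order: "is_order A \<iota> B"
    and \<epsilon>_sign: "\<epsilon> \<in> {1, -1}"
    and right_module: "right_module act"
    and lattice: "free_lattice \<iota> act B n L"
    and hermitian: "hermitian_form act \<sigma> \<epsilon> h"
    and nondeg: "nondegenerate h"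
    and reflexive: "dual_lattice h B (dual_lattice h B L) = L"
begin

abbreviation Ld :: "'v set" where
  "Ld \<equiv> dual_lattice h B L"

lemma \<iota>_simps [simp]: "\<iota> 1 = 1" "\<iota> 0 = 0" "\<iota> (a + b) = \<iota> a + \<iota> b" "\<iota> (a * b) = \<iota> a * \<iota> b"
proof -
  show add: "\<iota> (a + b) = \<iota> a + \<iota> b" for a b
    using \<iota>_hom by (simp add: unital_ring_hom_on_def)
  show "\<iota> 0 = 0"
    using add[of 0 0] by simp
qed (use \<iota>_hom in \<open>simp_all add: unital_ring_hom_on_def\<close>)

lemma \<iota>_commute: "x * \<iota> a = \<iota> a * x"
  proof -
  have "\<iota> a \<in> ring_center"
    using \<iota>_central by blast
  then show ?thesis
    by (simp add: ring_center_def)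
qed

lemma \<iota>_inverse: "a \<noteq> 0 \<Longrightarrow> \<iota> a * \<iota> (inverse a) = 1" "a \<noteq> 0 \<Longrightarrow> \<iota> (inverse a) * \<iota> a = 1"
  by (metis \<iota>_simps(1,4) right_inverse) (metis \<iota>_simps(1,4) left_inverse)

lemma \<sigma>_simps [simp]: "\<sigma> 1 = 1" "\<sigma> 0 = 0" "\<sigma> (x + y) = \<sigma> x + \<sigma> y" "\<sigma> (- x) = - \<sigma> x"
  using \<sigma>_\<iota>[of 1] additive.zero[OF \<sigma>_additive] additive.add[OF \<sigma>_additive] additive.minus[OF \<sigma>_additive]
  by simp_all

lemma \<epsilon>_simps [simp]: "\<epsilon> * \<epsilon> = 1" "\<epsilon> * (\<epsilon> * x) = x" "\<sigma> \<epsilon> = \<epsilon>"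
  using \<epsilon>_sign by auto

lemma \<epsilon>_commute: "x * \<epsilon> = \<epsilon> * x"
  using \<epsilon>_sign by auto

lemma B_subgroup: "add_subgroup B"
proof -
  have "1 \<in> B" "\<And>x y. x \<in> B \<Longrightarrow> y \<in> B \<Longrightarrow> x - y \<in> B"
    using order by (auto simp: is_order_def)
  then show ?thesis
    unfolding add_subgroup_def by (metis diff_self)
qed

lemmas B_closed = add_subgroupD[OF B_subgroup]

lemma one_B: "1 \<in> B" and mult_B: "x \<in> B \<Longrightarrow> y \<in> B \<Longrightarrow> x * y \<in> B"
  using order by (auto simp: is_order_def)

lemma \<epsilon>_B: "x \<in> B \<Longrightarrow> \<epsilon> * x \<in> B"
  using \<epsilon>_sign B_closed(3) by auto

lemma \<epsilon>_B_iff: "\<epsilon> * x \<in> B \<longleftrightarrow> x \<in> B"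
  using \<epsilon>_B[of x] \<epsilon>_B[of "\<epsilon> * x"] by auto

lemma generators:
  obtains S where "finite S" "B = {\<Sum>s\<in>S. \<iota> (c s) * s | c. \<forall>s\<in>S. c s \<in> A}"
  using order by (auto simp: is_order_def)

lemma scale_B: "a \<in> A \<Longrightarrow> x \<in> B \<Longrightarrow> \<iota> a * x \<in> B"
proof -
  assume a: "a \<in> A" and x: "x \<in> B"
  obtain S where S: "B = {\<Sum>s\<in>S. \<iota> (c s) * s | c. \<forall>s\<in>S. c s \<in> A}"
    using generators .
  obtain c where c: "x = (\<Sum>s\<in>S. \<iota> (c s) * s)" "\<forall>s\<in>S. c s \<in> A"
    using x S by auto
  have "\<iota> a * x = (\<Sum>s\<in>S. \<iota> (a * c s) * s)"
    by (simp add: c sum_distrib_left mult.assoc)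
  moreover have "\<forall>s\<in>S. a * c s \<in> A"
    using a c A_mult by blast
  ultimately show ?thesis
    unfolding S by (intro CollectI exI[of _ "\<lambda>s. a * c s"]) simp
qed

text \<open>An order supplies denominators in \<open>F\<close>, but only denominators in
  \<open>A\<close> can be multiplied together without leaving \<open>B\<close>. If \<open>a\<close>
  is not in \<open>A\<close>, its inverse is, and then \<open>x\<close> itself lies in
  \<open>B\<close>.\<close>

lemma integral_denominator: "\<exists>a\<in>A. a \<noteq> 0 \<and> \<iota> a * x \<in> B"
proof -
  obtain a where a: "a \<noteq> 0" "\<iota> a * x \<in> B"
    using order unfolding is_order_def by meson
  show ?thesis
  proof (cases "a \<in> A")
    case False
    then have "inverse a \<in> A"
      using A_inverse a by blast
    then have "\<iota> (inverse a) * (\<iota> a * x) \<in> B"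
      using a scale_B by blast
    then have "\<iota> 1 * x \<in> B"
      using a(1) by (simp add: mult.assoc[symmetric] \<iota>_inverse)
    then show ?thesis
      using A_inverse[of 1] by (intro bexI[of _ 1]) auto
  qed (use a in blast)
qed

lemma common_denominator:
  "finite I \<Longrightarrow> \<exists>a. a \<noteq> 0 \<and> (\<forall>i\<in>I. \<iota> a * x i \<in> B)"
proof -
  have "\<exists>a\<in>A. a \<noteq> 0 \<and> (\<forall>i\<in>I. \<iota> a * x i \<in> B)" if "finite I"
    using that
  proof induction
    case empty
    then show ?case
      using A_inverse[of 1] by (intro bexI[of _ 1]) auto
  next
    case (insert j I)
    obtain a where a: "a \<in> A" "a \<noteq> 0" "\<forall>i\<in>I. \<iota> a * x i \<in> B"
      using insert by blast
    obtain b where b: "b \<in> A" "b \<noteq> 0" "\<iota> b * x j \<in> B"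
      using integral_denominator by blast
    have "\<iota> (b * a) * x i \<in> B" if "i \<in> I" for i
      using scale_B[OF b(1)] a(3) that by (simp add: mult.assoc)
    moreover have "\<iota> (b * a) * x j \<in> B"
      using scale_B[OF a(1) b(3)]
      by (simp add: mult.assoc[symmetric] \<iota>_simps(4)[symmetric] mult.commute del: \<iota>_simps(4))
    ultimately show ?case
      using a b A_mult by (intro bexI[of _ "b * a"]) auto
  qed
  then show "finite I \<Longrightarrow> ?thesis"
    by blast
qed

lemma act_biadditive: "biadditive act" and act_mult: "act x (a * b) = act (act x a) b"
  and act_one [simp]: "act x 1 = x"
  using right_module by (simp_all add: right_module_def)

lemmas act_simps = biadditive_simps[OF act_biadditive]

lemma h_biadditive: "biadditive h" and h_act: "h (act x a) (act y b) = \<sigma> a * h x y * b"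
  and h_sym: "h y x = \<epsilon> * \<sigma> (h x y)"
  using hermitian unfolding hermitian_form_def by blast+

lemmas h_simps = biadditive_simps[OF h_biadditive]

lemma h_act_right: "h x (act y b) = h x y * b" and h_act_left: "h (act x a) y = \<sigma> a * h x y"
  using h_act[of x 1 y b] h_act[of x a y 1] by simp_all

lemma nondegenerate_left: "(\<And>y. h x y = 0) \<Longrightarrow> x = 0"
  using nondeg by (auto simp: nondegenerate_def)

lemma vector_space_V: "vector_space (\<lambda>a v. act v (\<iota> a))"
proof
  show "act (act v (\<iota> b)) (\<iota> a) = act v (\<iota> (a * b))" for a b v
    by (simp add: act_mult[symmetric] \<iota>_simps(4)[symmetric] mult.commute del: \<iota>_simps(4))
qed (simp_all add: act_simps)

text \<open>Clearing denominators turns the \<open>B\<close>-basis of \<open>L\<close> into a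
  \<open>K\<close>-basis of the ambient space: spanning because some multiple of \<open>x\<close>
  lies in \<open>L\<close>, independence because a common denominator of the coefficients is central
  and can be pulled out of the sum.\<close>

lemma lattice_basis:
  "\<exists>e. L = {\<Sum>i<n. act (e i) (b i) | b. \<forall>i<n. b i \<in> B} \<and>
    (\<forall>x. \<exists>c. x = (\<Sum>i<n. act (e i) (c i))) \<and>
    (\<forall>c. (\<Sum>i<n. act (e i) (c i)) = 0 \<longrightarrow> (\<forall>i<n. c i = 0))"
proof -
  obtain e where e: "L = {\<Sum>i<n. act (e i) (b i) | b. \<forall>i<n. b i \<in> B}"
    "\<And>b. (\<forall>i<n. b i \<in> B) \<Longrightarrow> (\<Sum>i<n. act (e i) (b i)) = 0 \<Longrightarrow> (\<forall>i<n. b i = 0)"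
    using lattice unfolding free_lattice_def free_of_rank_def by blast
  show ?thesis
  proof (intro exI[of _ e] conjI allI impI)
    show "L = {\<Sum>i<n. act (e i) (b i) | b. \<forall>i<n. b i \<in> B}"
      by (rule e(1))
  next
    fix x
    obtain a where a: "a \<noteq> 0" "act x (\<iota> a) \<in> L"
      using lattice unfolding free_lattice_def by blast
    then obtain b where "act x (\<iota> a) = (\<Sum>i<n. act (e i) (b i))"
      unfolding e(1) by blast
    then have "act (act x (\<iota> a)) (\<iota> (inverse a)) = (\<Sum>i<n. act (e i) (b i * \<iota> (inverse a)))"
      by (simp add: act_simps act_mult)
    then have "x = (\<Sum>i<n. act (e i) (b i * \<iota> (inverse a)))"
      using a by (simp add: act_mult[symmetric] \<iota>_inverse)
    then show "\<exists>c. x = (\<Sum>i<n. act (e i) (c i))"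
      by (rule exI[of _ "\<lambda>i. b i * \<iota> (inverse a)"])
  next
    fix c i assume c: "(\<Sum>i<n. act (e i) (c i)) = 0" and i: "i < n"
    obtain a where a: "a \<noteq> 0" "\<forall>i\<in>{..<n}. \<iota> a * c i \<in> B"
      using common_denominator[of "{..<n}" c] by auto
    have "(\<Sum>i<n. act (e i) (\<iota> a * c i)) = act (\<Sum>i<n. act (e i) (c i)) (\<iota> a)"
      by (simp add: act_simps act_mult[symmetric] \<iota>_commute)
    then have "(\<Sum>i<n. act (e i) (\<iota> a * c i)) = 0"
      by (simp add: c act_simps)
    then have "\<iota> a * c i = 0"
      using e(2)[of "\<lambda>i. \<iota> a * c i"] a(2) i by blast
    then have "\<iota> (inverse a) * \<iota> a * c i = 0"
      by (simp add: mult.assoc del: \<iota>_simps)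
    then show "c i = 0"
      using a(1) by (simp add: \<iota>_inverse del: \<iota>_simps)
  qed
qed

text \<open>The products of basis vectors of \<open>L\<close> with generators of \<open>B\<close>
  over \<open>A\<close> span the space over \<open>F\<close>. Counting dimensions over
  \<open>F\<close> treats division algebras and the split \<open>K\<close> alike.\<close>

lemma finite_dimensional:
  obtains b where "finite_dimensional_vector_space (\<lambda>a v. act v (\<iota> a)) b"
proof -
  interpret VS: vector_space "\<lambda>a v. act v (\<iota> a)"
    by (rule vector_space_V)
  obtain S where S: "finite S" "B = {\<Sum>s\<in>S. \<iota> (c s) * s | c. \<forall>s\<in>S. c s \<in> A}"
    using generators .
  obtain e where e: "L = {\<Sum>i<n. act (e i) (b i) | b. \<forall>i<n. b i \<in> B}"
    using lattice_basis by blast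
  let ?G = "(\<lambda>(i, s). act (e i) s) ` ({..<n} \<times> S)"
  have G: "act (e i) b \<in> VS.span ?G" if i: "i < n" and b: "b \<in> B" for i b
  proof -
    obtain c where "b = (\<Sum>s\<in>S. \<iota> (c s) * s)"
      using b S by auto
    then have "act (e i) b = (\<Sum>s\<in>S. act (act (e i) s) (\<iota> (c s)))"
      by (simp add: act_simps act_mult[symmetric] \<iota>_commute)
    moreover have "act (act (e i) s) (\<iota> (c s)) \<in> VS.span ?G" if "s \<in> S" for s
      using i that by (intro VS.span_scale VS.span_base) auto
    ultimately show ?thesis
      by (simp add: VS.span_sum)
  qed
  have span: "x \<in> VS.span ?G" for x
  proof -
    obtain a where a: "a \<noteq> 0" "act x (\<iota> a) \<in> L"
      using lattice unfolding free_lattice_def by blast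
    then have "act x (\<iota> a) \<in> VS.span ?G"
      unfolding e by (auto intro!: VS.span_sum G)
    then have "act (act x (\<iota> a)) (\<iota> (inverse a)) \<in> VS.span ?G"
      by (rule VS.span_scale)
    then show ?thesis
      using a by (simp add: act_mult[symmetric] \<iota>_inverse)
  qed
  obtain b where b: "b \<subseteq> ?G" "VS.independent b" "?G \<subseteq> VS.span b"
    by (rule VS.maximal_independent_subset)
  have "finite b"
    using b(1) S(1) by (meson finite_SigmaI finite_imageI finite_lessThan finite_subset)
  moreover have "VS.span b = UNIV"
    using VS.span_minimal[OF b(3) VS.subspace_span] span by auto
  ultimately have "finite_dimensional_vector_space (\<lambda>a v. act v (\<iota> a)) b"
    using b(2) by unfold_locales
  then show thesis
    by (rule that)
qed

text \<open>\<open>e'\<close> occupies the first argument of \<open>h\<close>, because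
  \<open>h\<close> is linear from the right in the second: so the coefficients
  \<open>h (e' i) v\<close> depend linearly on \<open>v\<close>.\<close>

definition dual_bases :: "(nat \<Rightarrow> 'v) \<Rightarrow> (nat \<Rightarrow> 'v) \<Rightarrow> bool" where
  "dual_bases e e' \<longleftrightarrow>
    L = {\<Sum>i<n. act (e i) (b i) | b. \<forall>i<n. b i \<in> B} \<and>
    (\<forall>i j. i < n \<longrightarrow> j < n \<longrightarrow> h (e' i) (e j) = (if i = j then 1 else 0)) \<and>
    (\<forall>v. v = (\<Sum>i<n. act (e i) (h (e' i) v)))"

text \<open>The \<open>F\<close>-linear endomorphism \<open>x \<mapsto> \<Sum>e\<^sub>i h(x, e\<^sub>i)\<close> is injective, hence surjective; the dual basis
  consists of the preimages of the \<open>e\<^sub>i\<close>.\<close>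

lemma dual_basis: "\<exists>e e'. dual_bases e e'"
proof -
  obtain e where e: "L = {\<Sum>i<n. act (e i) (b i) | b. \<forall>i<n. b i \<in> B}"
    "\<And>x. \<exists>c. x = (\<Sum>i<n. act (e i) (c i))"
    "\<And>c i. (\<Sum>i<n. act (e i) (c i)) = 0 \<Longrightarrow> i < n \<Longrightarrow> c i = 0"
    using lattice_basis by blast
  obtain b where "finite_dimensional_vector_space (\<lambda>a v. act v (\<iota> a)) b"
    using finite_dimensional .
  then interpret VS: finite_dimensional_vector_space "\<lambda>a v. act v (\<iota> a)" b .
  define g where "g x = (\<Sum>i<n. act (e i) (h x (e i)))" for x
  \<comment> \<open>Over \<open>K\<close> the map \<open>g\<close> need not be linear, as a scalar
    leaves the first argument of \<open>h\<close> through \<sigma>; it is linear over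
    \<open>F\<close> because \<sigma> fixes \<open>F\<close>.\<close>
  have lin: "Vector_Spaces.linear (\<lambda>a v. act v (\<iota> a)) (\<lambda>a v. act v (\<iota> a)) g"
    by (intro Vector_Spaces.linear.intro module_hom.intro module_hom_axioms.intro VS.vector_space_axioms VS.module_axioms)
      (simp_all add: g_def h_simps act_simps sum.distrib h_act_left \<sigma>_\<iota> act_mult[symmetric] \<iota>_commute)
  have "x = y" if "g x = g y" for x y
  proof -
    have "(\<Sum>i<n. act (e i) (h (x - y) (e i))) = 0"
      using that by (simp add: g_def h_simps act_simps sum_subtractf)
    then have zero: "h (x - y) (e i) = 0" if "i < n" for i
      using e(3)[of "\<lambda>i. h (x - y) (e i)" i] that by blast
    have "h (x - y) z = 0" for z
    proof -
      obtain c where "z = (\<Sum>i<n. act (e i) (c i))"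
        using e(2) by blast
      then have "h (x - y) z = (\<Sum>i<n. h (x - y) (e i) * c i)"
        by (simp add: biadditive_simps(10)[OF h_biadditive] h_act_right)
      also have "\<dots> = 0"
        by (intro sum.neutral) (simp add: zero)
      finally show ?thesis .
    qed
    then have "x - y = 0"
      by (rule nondegenerate_left)
    then show ?thesis
      by simp
  qed
  then have "inj g"
    by (rule injI)
  then have "surj g"
    by (rule VS.linear_inj_imp_surj[OF lin])
  define e' where "e' i = inv_into UNIV g (e i)" for i
  have e': "g (e' i) = e i" for i
    using \<open>surj g\<close> by (simp add: e'_def surj_f_inv_f)
  have dual: "h (e' i) (e j) = (if i = j then 1 else 0)" if ij: "i < n" "j < n" for i j
  proof -
    \<comment> \<open>The equation \<open>g (e' i) = e i\<close> is compared coefficient by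
      coefficient in the basis \<open>e\<close>.\<close>
    have "(\<Sum>j<n. act (e j) (h (e' i) (e j) - (if i = j then 1 else 0))) = g (e' i) - e i"
      using ij by (simp add: act_simps sum_subtractf g_def if_distrib[of "act _"] sum.delta' cong: if_cong)
    then have "(\<Sum>j<n. act (e j) (h (e' i) (e j) - (if i = j then 1 else 0))) = 0"
      by (simp add: e')
    then have "h (e' i) (e j) - (if i = j then 1 else 0) = 0"
      by (rule e(3)) (rule ij)
    then show ?thesis
      by simp
  qed
  have "v = (\<Sum>i<n. act (e i) (h (e' i) v))" for v
  proof -
    obtain c where c: "v = (\<Sum>i<n. act (e i) (c i))"
      using e(2) by blast
    have "h (e' i) v = c i" if "i < n" for i
    proof -
      have "h (e' i) v = (\<Sum>j<n. (if i = j then 1 else 0) * c j)"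
        unfolding c biadditive_simps(10)[OF h_biadditive] h_act_right
        by (intro sum.cong refl) (use that dual in auto)
      also have "\<dots> = c i"
        using that by (simp add: if_distribR if_distrib[of "\<lambda>x. x * _"] cong: if_cong)
      finally show ?thesis .
    qed
    then show ?thesis
      by (subst c) (intro sum.cong refl, simp)
  qed
  with e(1) dual show ?thesis
    unfolding dual_bases_def by blast
qed

definition e :: "nat \<Rightarrow> 'v" where "e = (SOME e. \<exists>e'. dual_bases e e')"

definition e' :: "nat \<Rightarrow> 'v" where "e' = (SOME e'. dual_bases e e')"

lemma dual_bases: "dual_bases e e'"
proof -
  have "\<exists>e'. dual_bases e e'"
    unfolding e_def using dual_basis by (rule someI_ex)
  then show ?thesis
    unfolding e'_def by (rule someI_ex)
qed

text \<open>As \<open>e\<close> and \<open>e'\<close> depend on \<open>L\<close>, unfolding with \<open>L_eq\<close> does not terminate.\<close>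

lemma L_eq: "L = {\<Sum>i<n. act (e i) (b i) | b. \<forall>i<n. b i \<in> B}"
  and h_dual: "i < n \<Longrightarrow> j < n \<Longrightarrow> h (e' i) (e j) = (if i = j then 1 else 0)"
  using dual_bases unfolding dual_bases_def by blast+

lemma expansion: "v = (\<Sum>i<n. act (e i) (h (e' i) v))"
  using dual_bases unfolding dual_bases_def by blast

lemma h_dual': "i < n \<Longrightarrow> j < n \<Longrightarrow> h (e i) (e' j) = (if i = j then \<epsilon> else 0)"
  using h_sym[of "e i" "e' j"] by (simp add: h_dual)

text \<open>The difference of both sides pairs to zero with every \<open>e j\<close>, hence with
  everything by \<open>expansion\<close>; the symmetry of \<open>h\<close> moves it to the first
  argument, where nondegeneracy is stated. The factor \<epsilon> cancels the value \<epsilon> of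
  \<open>h (e i) (e' i)\<close>.\<close>

lemma expansion': "v = (\<Sum>i<n. act (e' i) (\<epsilon> * h (e i) v))"
proof -
  let ?v = "v - (\<Sum>i<n. act (e' i) (\<epsilon> * h (e i) v))"
  have zero: "h (e j) ?v = 0" if j: "j < n" for j
  proof -
    have "h (e j) ?v = h (e j) v - (\<Sum>i<n. (if i = j then \<epsilon> * (\<epsilon> * h (e j) v) else 0))"
      unfolding biadditive_simps(8,10)[OF h_biadditive] h_act_right
      by (intro arg_cong2[of _ _ _ _ "(-)"] refl sum.cong) (use j h_dual' in auto)
    also have "\<dots> = 0"
      using j by simp
    finally show ?thesis .
  qed
  have "h y ?v = 0" for y
  proof -
    have "h y ?v = (\<Sum>i<n. \<sigma> (h (e' i) y) * h (e i) ?v)"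
      by (subst expansion[of y]) (simp only: biadditive_simps(9)[OF h_biadditive] h_act_left)
    also have "\<dots> = 0"
      by (intro sum.neutral) (simp add: zero)
    finally show ?thesis .
  qed
  then have "h ?v y = 0" for y
    by (subst h_sym) simp
  then have "?v = 0"
    by (rule nondegenerate_left)
  then show ?thesis
    by simp
qed

lemma h_Ld_L: "x \<in> Ld \<Longrightarrow> y \<in> L \<Longrightarrow> h x y \<in> B"
  by (simp add: dual_lattice_def)

text \<open>\<open>dual_lattice\<close> controls \<open>h\<close> only with the dual vector in the
  first argument, and exchanging the arguments would need stability of \<open>B\<close> under
  \<sigma>, which is deduced from this lemma. Reflexivity gives the other order directly.\<close>

lemma h_L_Ld: "x \<in> L \<Longrightarrow> y \<in> Ld \<Longrightarrow> h x y \<in> B"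
proof -
  assume "x \<in> L" and y: "y \<in> Ld"
  then have "x \<in> dual_lattice h B Ld"
    by (simp only: reflexive)
  then show ?thesis
    using y by (simp add: dual_lattice_def[of h B Ld])
qed

text \<open>Dual lattices are visibly closed under sums, and \<open>L\<close> is one by reflexivity.
  This is for values \<open>q (x + y)\<close> in the quadratic case.\<close>

lemma L_add: "x \<in> L \<Longrightarrow> y \<in> L \<Longrightarrow> x + y \<in> L"
proof -
  assume "x \<in> L" "y \<in> L"
  then have "x \<in> dual_lattice h B Ld" "y \<in> dual_lattice h B Ld"
    by (simp_all only: reflexive)
  then have "x + y \<in> dual_lattice h B Ld"
    unfolding dual_lattice_def[of h B Ld] by (simp add: h_simps B_closed)
  then show ?thesis
    by (simp only: reflexive)
qed

lemma e_act_L: "i < n \<Longrightarrow> b \<in> B \<Longrightarrow> act (e i) b \<in> L"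
proof -
  assume *: "i < n" "b \<in> B"
  have "(\<Sum>j<n. act (e j) (if j = i then b else 0)) = (\<Sum>j<n. if j = i then act (e i) b else 0)"
    by (intro sum.cong refl) (simp add: act_simps)
  also have "\<dots> = act (e i) b"
    using * by simp
  finally have sum: "act (e i) b = (\<Sum>j<n. act (e j) (if j = i then b else 0))" ..
  have mem: "\<forall>j<n. (if j = i then b else 0) \<in> B"
    using * B_closed(1) by simp
  show ?thesis
    by (subst L_eq) (rule CollectI, rule exI, rule conjI, rule sum, rule mem)
qed

lemma e_L: "i < n \<Longrightarrow> e i \<in> L"
  using e_act_L[OF _ one_B] by simp

lemma e'_Ld: "i < n \<Longrightarrow> e' i \<in> Ld"
proof -
  assume i: "i < n"
  have "h (e' i) y \<in> B" if y: "y \<in> L" for y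
  proof -
    obtain b where b: "y = (\<Sum>j<n. act (e j) (b j))" "\<forall>j<n. b j \<in> B"
      using subsetD[OF equalityD1[OF L_eq] y] by blast
    have "h (e' i) (e j) * b j \<in> B" if j: "j < n" for j
      unfolding h_dual[OF i j] using j b(2) B_closed(1) by (cases "i = j") auto
    then show ?thesis
      unfolding b(1) biadditive_simps(10)[OF h_biadditive] h_act_right
      by (intro add_subgroup_sum[OF B_subgroup]) simp
  qed
  then show ?thesis
    by (simp add: dual_lattice_def)
qed

text \<open>Reflexivity forces \<open>\<sigma>(B) \<subseteq> B\<close> as soon as \<open>L \<noteq> 0\<close>: the lattice \<open>L\<close> is a \<open>B\<close>-module, while a dual
  lattice is only a module over \<open>{b. \<sigma> b \<in> B}\<close>.\<close>

lemma \<sigma>_B: "i < n \<Longrightarrow> b \<in> B \<Longrightarrow> \<sigma> b \<in> B"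
  using h_L_Ld[OF e_act_L e'_Ld, of i b i] by (simp add: h_act_left h_dual' \<epsilon>_commute \<epsilon>_B_iff)

text \<open>The scalar leaves the first argument of \<open>h\<close> as \<open>\<sigma> b\<close>,
  whence the appeal to \<open>\<sigma>_B\<close>.\<close>

lemma e'_act_Ld: "i < n \<Longrightarrow> b \<in> B \<Longrightarrow> act (e' i) b \<in> Ld"
  using h_Ld_L[OF e'_Ld, of i] \<sigma>_B mult_B by (simp add: dual_lattice_def h_act_left)

end

section \<open>Base change of the lattice\<close>

lemma additive_id: "additive (\<lambda>x. x)"
  by (simp add: additive_def)

lemma additive_biadditive_left: "biadditive f \<Longrightarrow> additive g \<Longrightarrow> additive (\<lambda>x. f (g x) y)"
  by (simp add: biadditive_def additive_def)

lemma additive_biadditive_right: "biadditive f \<Longrightarrow> additive g \<Longrightarrow> additive (\<lambda>x. f y (g x))"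
  by (simp add: biadditive_def additive_def)

locale tensor_product_pair =
  T1: tensor_product A sm1 sn1 t1 + T2: tensor_product A sm2 sn2 t2
  for A :: "'a set" and sm1 :: "'a \<Rightarrow> 'm::ab_group_add \<Rightarrow> 'm" and sn1 :: "'a \<Rightarrow> 'n::ab_group_add \<Rightarrow> 'n"
    and t1 :: "'m \<Rightarrow> 'n \<Rightarrow> 's::ab_group_add"
    and sm2 :: "'a \<Rightarrow> 'p::ab_group_add \<Rightarrow> 'p" and sn2 :: "'a \<Rightarrow> 'q::ab_group_add \<Rightarrow> 'q"
    and t2 :: "'p \<Rightarrow> 'q \<Rightarrow> 't::ab_group_add"
begin

text \<open>Lifting in the inner pair of variables leaves a function that is again biadditive and
  balanced in the outer pair, by uniqueness of lifts. Both \<open>extend_action\<close> and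
  \<open>extend_form\<close> have this shape.\<close>

lemma nested_lift:
  fixes g :: "'m \<Rightarrow> 'n \<Rightarrow> 'p \<Rightarrow> 'q \<Rightarrow> 'g::ab_group_add"
  assumes inner: "\<And>x y. biadditive (g x y)" and outer: "\<And>z w. biadditive (\<lambda>x y. g x y z w)"
    and bal_inner: "\<And>a x y z w. a \<in> A \<Longrightarrow> g x y (sm2 a z) w = g x y z (sn2 a w)"
    and bal_outer: "\<And>a x y z w. a \<in> A \<Longrightarrow> g (sm1 a x) y z w = g x (sn1 a y) z w"
  defines "G \<equiv> \<lambda>u v. tensor_lift t1 (\<lambda>x y. tensor_lift t2 (\<lambda>z w. g x y z w) v) u"
  shows "biadditive G" "G (t1 x y) (t2 z w) = g x y z w"
proof -
  let ?l = "\<lambda>x y. tensor_lift t2 (\<lambda>z w. g x y z w)"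
  have add: "additive (?l x y)" and val: "?l x y (t2 z w) = g x y z w" for x y z w
    using T2.tensor_lift[of "g x y"] inner bal_inner by auto
  have bi: "biadditive (\<lambda>x y. ?l x y v)" for v
  proof (rule biadditiveI)
    show "?l (x + x') y v = ?l x y v + ?l x' y v" for x x' y
      by (rule T2.additive_eqI[OF add additive_plus[OF add add]])
        (simp only: val, rule biadditive_simps(1)[OF outer])
    show "?l x (y + y') v = ?l x y v + ?l x y' v" for x y y'
      by (rule T2.additive_eqI[OF add additive_plus[OF add add]])
        (simp only: val, rule biadditive_simps(2)[OF outer])
  qed
  have bal: "?l (sm1 a x) y v = ?l x (sn1 a y) v" if "a \<in> A" for a x y v
    by (rule T2.additive_eqI[OF add add]) (simp add: val bal_outer that)
  have G1: "additive (\<lambda>u. G u v)" and G2: "G (t1 x y) v = ?l x y v" for x y v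
    unfolding G_def using T1.tensor_lift[OF bi bal] by auto
  show "biadditive G"
  proof (rule biadditiveI)
    show "G (u + u') v = G u v + G u' v" for u u' v
      by (rule additive.add[OF G1])
    show "G u (v + v') = G u v + G u v'" for u v v'
      by (rule T1.additive_eqI[of "\<lambda>u. G u (v + v')" "\<lambda>u. G u v + G u v'"])
        (simp_all add: G1 additive_plus G2 additive.add[OF add])
  qed
  show "G (t1 x y) (t2 z w) = g x y z w"
    by (simp add: G2 val)
qed

end

lemma extend_lattice_induct:
  assumes "x \<in> extend_lattice t N" "add_subgroup H" "\<And>v r. v \<in> N \<Longrightarrow> t v r \<in> H"
  shows "x \<in> H"
proof -
  have "extend_lattice t N \<subseteq> H"
    unfolding extend_lattice_def
    by (rule add_subgroup_hull_subset[OF assms(2)]) (auto intro: assms(3))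
  then show ?thesis
    using assms(1) by blast
qed

lemma extend_lattice_subgroup: "add_subgroup (extend_lattice t N)"
  unfolding extend_lattice_def by (rule add_subgroup_hull)

lemma extend_lattice_pure: "v \<in> N \<Longrightarrow> t v r \<in> extend_lattice t N"
  unfolding extend_lattice_def by (rule hull_inc) blast

locale base_changed_lattice = hermitian_lattice A \<iota> \<sigma> \<epsilon> B act L n h
  for A :: "'f::field set" and \<iota> :: "'f \<Rightarrow> 'k::ring_1" and \<sigma> :: "'k \<Rightarrow> 'k" and \<epsilon> :: 'k
    and B :: "'k set" and act :: "'v::ab_group_add \<Rightarrow> 'k \<Rightarrow> 'v" and L :: "'v set" and n :: nat
    and h :: "'v \<Rightarrow> 'v \<Rightarrow> 'k" +
  fixes \<alpha> :: "'f \<Rightarrow> 'r::{comm_ring,comm_monoid_mult}"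
    and tK :: "'k \<Rightarrow> 'r \<Rightarrow> 's::{ring,monoid_mult}" and tV :: "'v \<Rightarrow> 'r \<Rightarrow> 'w::ab_group_add"
  assumes base_K: "is_base_changed_algebra A \<iota> \<alpha> tK"
    and base_V: "is_base_changed_module A \<iota> act \<alpha> tV"

sublocale base_changed_lattice \<subseteq> K: tensor_product A "\<lambda>a x. \<iota> a * x" "\<lambda>a r. \<alpha> a * r" tK
  using base_K by unfold_locales (simp add: is_base_changed_algebra_def)

sublocale base_changed_lattice \<subseteq> V: tensor_product A "\<lambda>a x. act x (\<iota> a)" "\<lambda>a r. \<alpha> a * r" tV
  using base_V by unfold_locales (simp add: is_base_changed_module_def)

context base_changed_lattice
begin

abbreviation "actR \<equiv> extend_action tK tV act"
abbreviation "hR \<equiv> extend_form tK tV h"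
abbreviation "\<sigma>R \<equiv> extend_involution tK \<sigma>"
abbreviation "\<epsilon>R \<equiv> tK \<epsilon> 1"
abbreviation "C \<equiv> extend_lattice tK B"
abbreviation "M \<equiv> extend_lattice tV L"
abbreviation "M' \<equiv> extend_lattice tV Ld"

lemma tK_one: "tK 1 1 = 1" and tK_mult: "tK x r * tK y s = tK (x * y) (r * s)"
  using base_K by (simp_all add: is_base_changed_algebra_def)

lemmas tK_simps = biadditive_simps[OF K.biadditive_pure]
lemmas tV_simps = biadditive_simps[OF V.biadditive_pure]

sublocale VK: tensor_product_pair A "\<lambda>a x. act x (\<iota> a)" "\<lambda>a r. \<alpha> a * r" tV "\<lambda>a x. \<iota> a * x" "\<lambda>a r. \<alpha> a * r" tK
  by unfold_locales

sublocale VV: tensor_product_pair A "\<lambda>a x. act x (\<iota> a)" "\<lambda>a r. \<alpha> a * r" tV "\<lambda>a x. act x (\<iota> a)" "\<lambda>a r. \<alpha> a * r" tV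
  by unfold_locales

text \<open>Balancedness over \<open>A\<close> rests on the centrality of \<iota>: a scalar may act
  before or after \<open>k\<close>.\<close>

lemma actR: "biadditive actR" "actR (tV v r) (tK k s) = tV (act v k) (r * s)"
proof -
  let ?g = "\<lambda>v r k s. tV (act v k) (r * s)"
  have 1: "biadditive (?g v r)" for v r
    by (rule biadditiveI) (simp_all add: act_simps tV_simps distrib_left)
  have 2: "biadditive (\<lambda>v r. ?g v r k s)" for k s
    by (rule biadditiveI) (simp_all add: act_simps tV_simps distrib_right)
  have 3: "?g v r (\<iota> a * k) s = ?g v r k (\<alpha> a * s)" if "a \<in> A" for a v r k s
  proof -
    have "act v (\<iota> a * k) = act (act v k) (\<iota> a)"
      by (simp only: \<iota>_commute[symmetric] act_mult)
    then show ?thesis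
      using V.pure_balanced[OF that] by (simp add: mult_ac)
  qed
  have 4: "?g (act v (\<iota> a)) r k s = ?g v (\<alpha> a * r) k s" if "a \<in> A" for a v r k s
  proof -
    have "act (act v (\<iota> a)) k = act (act v k) (\<iota> a)"
      by (simp only: \<iota>_commute act_mult[symmetric])
    then show ?thesis
      using V.pure_balanced[OF that] by (simp add: mult_ac)
  qed
  show "biadditive actR" "actR (tV v r) (tK k s) = tV (act v k) (r * s)"
    unfolding extend_action_def using VK.nested_lift[of ?g, OF 1 2 3 4] by simp_all
qed

text \<open>A sesquilinear form is balanced over \<open>A\<close> in its first argument because
  \<sigma> fixes the scalars.\<close>

lemma hR: "biadditive hR" "hR (tV v r) (tV w s) = tK (h v w) (r * s)"
proof -
  let ?g = "\<lambda>v r w s. tK (h v w) (r * s)"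
  have 1: "biadditive (?g v r)" for v r
    by (rule biadditiveI) (simp_all add: h_simps tK_simps distrib_left)
  have 2: "biadditive (\<lambda>v r. ?g v r w s)" for w s
    by (rule biadditiveI) (simp_all add: h_simps tK_simps distrib_right)
  have 3: "?g v r (act w (\<iota> a)) s = ?g v r w (\<alpha> a * s)" if "a \<in> A" for a v r w s
    using K.pure_balanced[OF that] by (simp add: h_act_right \<iota>_commute mult_ac)
  have 4: "?g (act v (\<iota> a)) r w s = ?g v (\<alpha> a * r) w s" if "a \<in> A" for a v r w s
    using K.pure_balanced[OF that] by (simp add: h_act_left \<sigma>_\<iota> mult_ac)
  show "biadditive hR" "hR (tV v r) (tV w s) = tK (h v w) (r * s)"
    unfolding extend_form_def using VV.nested_lift[of ?g, OF 1 2 3 4] by simp_all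
qed

lemma \<sigma>R: "additive \<sigma>R" "\<sigma>R (tK k r) = tK (\<sigma> k) r"
proof -
  have 1: "biadditive (\<lambda>k r. tK (\<sigma> k) r)"
    by (rule biadditiveI) (simp_all add: tK_simps)
  have 2: "tK (\<sigma> (\<iota> a * k)) r = tK (\<sigma> k) (\<alpha> a * r)" if "a \<in> A" for a k r
    using K.pure_balanced[OF that] by (simp add: \<sigma>_mult \<sigma>_\<iota> \<iota>_commute)
  show "additive \<sigma>R" "\<sigma>R (tK k r) = tK (\<sigma> k) r"
    unfolding extend_involution_def using K.tensor_lift[of "\<lambda>k r. tK (\<sigma> k) r", OF 1 2] by simp_all
qed

lemmas actR_simps = biadditive_simps[OF actR(1)]
lemmas hR_simps = biadditive_simps[OF hR(1)]

lemmas additive_intros = additive_id additive_plus additive_sum_map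
  additive_biadditive_left[OF actR(1)] additive_biadditive_right[OF actR(1)]
  additive_biadditive_left[OF hR(1)] additive_biadditive_right[OF hR(1)]
  additive_compose[OF \<sigma>R(1)] additive_compose[OF additive_mult_left] additive_compose[OF additive_mult_right]

lemma \<epsilon>R_simps [simp]: "\<epsilon>R * \<epsilon>R = 1" "\<epsilon>R * (\<epsilon>R * x) = x"
proof -
  show "\<epsilon>R * \<epsilon>R = 1"
    by (simp add: tK_mult tK_one)
  then show "\<epsilon>R * (\<epsilon>R * x) = x"
    by (simp add: mult.assoc[symmetric])
qed

lemma \<epsilon>R_commute: "x * \<epsilon>R = \<epsilon>R * x"
  by (rule K.additive_eqI[of "\<lambda>x. x * \<epsilon>R"])
    (simp_all add: additive_mult_left additive_mult_right tK_mult \<epsilon>_commute mult.commute)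

text \<open>Both sides are additive in each of \<open>x\<close>, \<open>a\<close> and
  \<open>b\<close>, so each variable in turn may be taken to be a pure tensor. The next three lemmas
  follow the same scheme.\<close>

lemma actR_mult: "actR x (a * b) = actR (actR x a) b"
proof (rule V.additive_eqI[of "\<lambda>x. actR x (a * b)" "\<lambda>x. actR (actR x a) b"])
  fix v r
  show "actR (tV v r) (a * b) = actR (actR (tV v r) a) b"
  proof (rule K.additive_eqI[of "\<lambda>a. actR (tV v r) (a * b)" "\<lambda>a. actR (actR (tV v r) a) b"])
    fix k s
    show "actR (tV v r) (tK k s * b) = actR (actR (tV v r) (tK k s)) b"
      by (rule K.additive_eqI[of "\<lambda>b. actR (tV v r) (tK k s * b)" "\<lambda>b. actR (actR (tV v r) (tK k s)) b"])
        (intro additive_intros | simp add: tK_mult actR act_mult mult.assoc)+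
  qed (intro additive_intros)+
qed (intro additive_intros)+

lemma hR_act_right: "hR x (actR y b) = hR x y * b"
proof (rule V.additive_eqI[of "\<lambda>x. hR x (actR y b)" "\<lambda>x. hR x y * b"])
  fix v r
  show "hR (tV v r) (actR y b) = hR (tV v r) y * b"
  proof (rule V.additive_eqI[of "\<lambda>y. hR (tV v r) (actR y b)" "\<lambda>y. hR (tV v r) y * b"])
    fix w s
    show "hR (tV v r) (actR (tV w s) b) = hR (tV v r) (tV w s) * b"
      by (rule K.additive_eqI[of "\<lambda>b. hR (tV v r) (actR (tV w s) b)" "\<lambda>b. hR (tV v r) (tV w s) * b"])
        (intro additive_intros | simp add: tK_mult actR hR h_act_right mult.assoc)+
  qed (intro additive_intros)+
qed (intro additive_intros)+

lemma hR_act_left: "hR (actR x a) y = \<sigma>R a * hR x y"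
proof (rule V.additive_eqI[of "\<lambda>x. hR (actR x a) y" "\<lambda>x. \<sigma>R a * hR x y"])
  fix v r
  show "hR (actR (tV v r) a) y = \<sigma>R a * hR (tV v r) y"
  proof (rule V.additive_eqI[of "\<lambda>y. hR (actR (tV v r) a) y" "\<lambda>y. \<sigma>R a * hR (tV v r) y"])
    fix w s
    show "hR (actR (tV v r) a) (tV w s) = \<sigma>R a * hR (tV v r) (tV w s)"
      by (rule K.additive_eqI[of "\<lambda>a. hR (actR (tV v r) a) (tV w s)" "\<lambda>a. \<sigma>R a * hR (tV v r) (tV w s)"])
        (intro additive_intros | simp add: tK_mult actR hR \<sigma>R h_act_left mult_ac)+
  qed (intro additive_intros)+
qed (intro additive_intros)+

lemma hR_sym: "hR y x = \<epsilon>R * \<sigma>R (hR x y)"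
proof (rule V.additive_eqI[of "\<lambda>x. hR y x" "\<lambda>x. \<epsilon>R * \<sigma>R (hR x y)"])
  fix v r
  show "hR y (tV v r) = \<epsilon>R * \<sigma>R (hR (tV v r) y)"
  proof (rule V.additive_eqI[of "\<lambda>y. hR y (tV v r)" "\<lambda>y. \<epsilon>R * \<sigma>R (hR (tV v r) y)"])
    fix w s
    show "hR (tV w s) (tV v r) = \<epsilon>R * \<sigma>R (hR (tV v r) (tV w s))"
      by (simp add: hR \<sigma>R tK_mult h_sym[symmetric] mult.commute)
  qed (intro additive_intros)+
qed (intro additive_intros)+

section \<open>Dual bases after base change\<close>

abbreviation E :: "nat \<Rightarrow> 'w" where "E i \<equiv> tV (e i) 1"
abbreviation E' :: "nat \<Rightarrow> 'w" where "E' i \<equiv> tV (e' i) 1"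

text \<open>For a pure tensor \<open>tV v r\<close> every coefficient is a pure tensor with second
  factor \<open>r\<close>, so the sum collapses to \<open>expansion\<close> tensored with
  \<open>r\<close>.\<close>

lemma expansionR: "x = (\<Sum>i<n. actR (E i) (hR (E' i) x))"
proof (rule V.additive_eqI[of "\<lambda>x. x" "\<lambda>x. \<Sum>i<n. actR (E i) (hR (E' i) x)"])
  fix v r
  have "(\<Sum>i<n. actR (E i) (hR (E' i) (tV v r))) = tV (\<Sum>i<n. act (e i) (h (e' i) v)) r"
    by (simp add: hR actR tV_simps)
  then show "tV v r = (\<Sum>i<n. actR (E i) (hR (E' i) (tV v r)))"
    by (simp only: expansion[symmetric])
qed (intro additive_intros)+

lemma expansionR': "x = (\<Sum>i<n. actR (E' i) (\<epsilon>R * hR (E i) x))"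
proof (rule V.additive_eqI[of "\<lambda>x. x" "\<lambda>x. \<Sum>i<n. actR (E' i) (\<epsilon>R * hR (E i) x)"])
  fix v r
  have "(\<Sum>i<n. actR (E' i) (\<epsilon>R * hR (E i) (tV v r))) = tV (\<Sum>i<n. act (e' i) (\<epsilon> * h (e i) v)) r"
    by (simp add: hR actR tV_simps tK_mult)
  then show "tV v r = (\<Sum>i<n. actR (E' i) (\<epsilon>R * hR (E i) (tV v r)))"
    by (simp only: expansion'[symmetric])
qed (intro additive_intros)+

text \<open>Nondegeneracy survives the base change because the coordinates of a vector along
  \<open>E\<close> are values of \<open>hR\<close>.\<close>

lemma hR_right_eqI: "(\<And>x. hR x y = hR x z) \<Longrightarrow> y = z"
  using expansionR[of y] expansionR[of z] by simp

lemmas C_subgroup = extend_lattice_subgroup[of tK B]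
lemmas M_subgroup = extend_lattice_subgroup[of tV L]
lemmas M'_subgroup = extend_lattice_subgroup[of tV Ld]

lemma C_\<epsilon>: "c \<in> C \<Longrightarrow> \<epsilon>R * c \<in> C"
proof -
  assume "c \<in> C"
  moreover have "add_subgroup {c. \<epsilon>R * c \<in> C}"
    by (rule add_subgroup_vimage[OF additive_mult_left C_subgroup])
  ultimately have "c \<in> {c. \<epsilon>R * c \<in> C}"
    by (rule extend_lattice_induct) (simp add: tK_mult extend_lattice_pure \<epsilon>_B)
  then show ?thesis
    by simp
qed

lemma actR_E_mem:
  assumes "\<And>b. b \<in> B \<Longrightarrow> act v b \<in> N" "c \<in> C"
  shows "actR (tV v 1) c \<in> extend_lattice tV N"
proof -
  have "add_subgroup {c. actR (tV v 1) c \<in> extend_lattice tV N}"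
    by (rule add_subgroup_vimage[OF biadditiveD(1)[OF actR(1)] extend_lattice_subgroup])
  with assms(2) have "c \<in> {c. actR (tV v 1) c \<in> extend_lattice tV N}"
    by (rule extend_lattice_induct) (simp add: actR extend_lattice_pure assms(1))
  then show ?thesis
    by simp
qed

text \<open>The coordinates of \<open>x\<close> along \<open>E\<close> are the values
  \<open>hR (E' i) x\<close>, and \<open>C\<close>-multiples of \<open>E i\<close> lie in
  \<open>M\<close>. Membership thus becomes finitely many conditions on \<open>hR\<close>, which an
  adjoint can be tested against.\<close>

lemma M_memI: "(\<And>i. i < n \<Longrightarrow> hR (E' i) x \<in> C) \<Longrightarrow> x \<in> M"
  by (subst expansionR, intro add_subgroup_sum[OF M_subgroup] actR_E_mem e_act_L) simp_all

lemma M'_memI: "(\<And>i. i < n \<Longrightarrow> hR (E i) x \<in> C) \<Longrightarrow> x \<in> M'"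
  by (subst expansionR', intro add_subgroup_sum[OF M'_subgroup] actR_E_mem e'_act_Ld C_\<epsilon>) simp_all

lemma hR_extend_lattice:
  assumes h: "\<And>v w. v \<in> N \<Longrightarrow> w \<in> N' \<Longrightarrow> h v w \<in> B"
    and x: "x \<in> extend_lattice tV N" and y: "y \<in> extend_lattice tV N'"
  shows "hR x y \<in> C"
proof -
  have pure: "hR (tV v r) y \<in> C" if v: "v \<in> N" for v r
  proof -
    have "add_subgroup {y. hR (tV v r) y \<in> C}"
      by (rule add_subgroup_vimage[OF biadditiveD(1)[OF hR(1)] C_subgroup])
    with y have "y \<in> {y. hR (tV v r) y \<in> C}"
      by (rule extend_lattice_induct) (simp add: hR extend_lattice_pure h v)
    then show ?thesis
      by simp
  qed
  have "add_subgroup {x. hR x y \<in> C}"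
    by (rule add_subgroup_vimage[OF biadditiveD(2)[OF hR(1)] C_subgroup])
  with x have "x \<in> {x. hR x y \<in> C}"
    by (rule extend_lattice_induct) (simp add: pure)
  then show ?thesis
    by simp
qed

lemma hR_M'_M: "x \<in> M' \<Longrightarrow> y \<in> M \<Longrightarrow> hR x y \<in> C"
  using hR_extend_lattice[OF h_Ld_L] .

lemma hR_M_M': "x \<in> M \<Longrightarrow> y \<in> M' \<Longrightarrow> hR x y \<in> C"
  using hR_extend_lattice[OF h_L_Ld] .

section \<open>Adjoints\<close>

abbreviation ad :: "('w \<Rightarrow> 'w) \<Rightarrow> 'w \<Rightarrow> 'w" where "ad \<equiv> adj actR hR"

lemma module_endoD:
  assumes "module_endo actR X"
  shows "X (x + y) = X x + X y" "X (actR x a) = actR (X x) a" "X (\<Sum>i\<in>I. f i) = (\<Sum>i\<in>I. X (f i))"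
    "additive X"
  using assms additive.add[of X] additive.sum[of X] by (simp_all add: module_endo_def)

lemma adjoint_exists:
  assumes X: "module_endo actR X"
  shows "\<exists>!Y. is_adjoint actR hR X Y"
proof -
  \<comment> \<open>This formula is forced: by \<open>expansionR'\<close> the coordinate of
    \<open>Y y\<close> along \<open>E' i\<close> is \<open>\<epsilon>R * hR (E i) (Y y)\<close>, and
    adjointness replaces \<open>hR (E i) (Y y)\<close> by \<open>hR (X (E i)) y\<close>.\<close>
  define Y where "Y y = (\<Sum>i<n. actR (E' i) (\<epsilon>R * hR (X (E i)) y))" for y
  have "additive Y"
    unfolding Y_def by (intro additive_intros)
  moreover have "Y (actR y a) = actR (Y y) a" for y a
    by (simp add: Y_def actR_simps hR_act_right mult.assoc[symmetric] actR_mult[symmetric])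
  moreover have "hR (X x) y = hR x (Y y)" for x y
  proof -
    have "hR (X x) y = hR (X (\<Sum>i<n. actR (E i) (hR (E' i) x))) y"
      by (simp only: expansionR[symmetric])
    also have "\<dots> = (\<Sum>i<n. \<sigma>R (hR (E' i) x) * hR (X (E i)) y)"
      by (simp only: module_endoD[OF X] hR_simps hR_act_left)
    \<comment> \<open>Exchanging the arguments of \<open>hR (E' i) x\<close> costs a factor
      \<open>\<epsilon>R\<close>, which cancels the one in \<open>Y\<close>.\<close>
    also have "\<dots> = (\<Sum>i<n. hR x (E' i) * (\<epsilon>R * hR (X (E i)) y))"
    proof (intro sum.cong refl)
      fix i
      have "hR x (E' i) * (\<epsilon>R * hR (X (E i)) y) = (\<epsilon>R * \<sigma>R (hR (E' i) x)) * (\<epsilon>R * hR (X (E i)) y)"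
        by (simp only: hR_sym[symmetric])
      also have "\<dots> = \<epsilon>R * (\<epsilon>R * \<sigma>R (hR (E' i) x)) * hR (X (E i)) y"
        by (simp only: mult.assoc[symmetric] \<epsilon>R_commute[of "\<epsilon>R * \<sigma>R (hR (E' i) x)"])
      finally show "\<sigma>R (hR (E' i) x) * hR (X (E i)) y = hR x (E' i) * (\<epsilon>R * hR (X (E i)) y)"
        by simp
    qed
    also have "\<dots> = hR x (Y y)"
      by (simp only: Y_def hR_simps hR_act_right)
    finally show ?thesis .
  qed
  ultimately have Y: "is_adjoint actR hR X Y"
    by (simp add: is_adjoint_def module_endo_def)
  show ?thesis
  proof (rule ex1I[of _ Y])
    show "is_adjoint actR hR X Y"
      by (rule Y)
    fix Z assume "is_adjoint actR hR X Z"
    then have "hR x (Z y) = hR x (Y y)" for x y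
      using Y by (simp add: is_adjoint_def)
    then show "Z = Y"
      by (intro ext hR_right_eqI)
  qed
qed

lemma is_adjoint_ad: "module_endo actR X \<Longrightarrow> is_adjoint actR hR X (ad X)"
  unfolding adj_def by (rule theI'[OF adjoint_exists])

lemma ad_endo: "module_endo actR X \<Longrightarrow> module_endo actR (ad X)"
  and hR_ad: "module_endo actR X \<Longrightarrow> hR x (ad X y) = hR (X x) y"
  using is_adjoint_ad[of X] by (simp_all add: is_adjoint_def)

lemma hR_ad_left: "module_endo actR X \<Longrightarrow> hR (ad X x) y = hR x (X y)"
  using hR_sym[of "ad X x" y] hR_sym[of x "X y"] by (simp add: hR_ad)

lemma ad_eqI:
  assumes "module_endo actR X" "\<And>x y. hR (X x) y = hR x (Y y)"
  shows "ad X = Y"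
  by (intro ext hR_right_eqI) (simp add: hR_ad assms)

abbreviation T0 :: "('w \<Rightarrow> 'w) set" where "T0 \<equiv> T_zero actR M M'"

lemma T0_endo: "X \<in> T0 \<Longrightarrow> module_endo actR X"
  and T0_M: "X \<in> T0 \<Longrightarrow> x \<in> M \<Longrightarrow> X x \<in> M"
  and T0_M': "X \<in> T0 \<Longrightarrow> x \<in> M' \<Longrightarrow> X x \<in> M'"
  by (auto simp: T_zero_def)

lemma T0_I:
  "module_endo actR X \<Longrightarrow> (\<And>x. x \<in> M \<Longrightarrow> X x \<in> M) \<Longrightarrow> (\<And>x. x \<in> M' \<Longrightarrow> X x \<in> M') \<Longrightarrow> X \<in> T0"
  by (auto simp: T_zero_def)

lemma T0_subgroup: "add_subgroup T0"
proof (rule add_subgroupI)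
  show "0 \<in> T0"
    using add_subgroupD(1)[OF M_subgroup] add_subgroupD(1)[OF M'_subgroup]
    by (intro T0_I) (simp_all add: module_endo_def additive_def actR_simps)
  show "X + Y \<in> T0" if "X \<in> T0" "Y \<in> T0" for X Y
  proof (rule T0_I)
    show "module_endo actR (X + Y)"
      using T0_endo[OF that(1)] T0_endo[OF that(2)]
      by (simp add: module_endo_def additive_def actR_simps add_ac)
  qed (simp_all add: T0_M T0_M' that add_subgroupD[OF M_subgroup] add_subgroupD[OF M'_subgroup])
  show "- X \<in> T0" if "X \<in> T0" for X
  proof (rule T0_I)
    show "module_endo actR (- X)"
      using T0_endo[OF that] by (simp add: module_endo_def additive_def actR_simps)
  qed (simp_all add: T0_M T0_M' that add_subgroupD[OF M_subgroup] add_subgroupD[OF M'_subgroup])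
qed

lemma T0_comp: "X \<in> T0 \<Longrightarrow> Y \<in> T0 \<Longrightarrow> X \<circ> Y \<in> T0"
  using T0_endo[of X] T0_endo[of Y]
  by (intro T0_I) (simp_all add: T0_M T0_M' module_endo_def additive_def)

text \<open>The roles of the lattices are exchanged: since
  \<open>hR (E' i) (ad X y) = hR (X (E' i)) y\<close>, the adjoint preserves \<open>M\<close>
  because \<open>X\<close> preserves \<open>M'\<close>, and conversely.\<close>

lemma T0_ad: "X \<in> T0 \<Longrightarrow> ad X \<in> T0"
proof -
  assume X: "X \<in> T0"
  note endo = T0_endo[OF X]
  show ?thesis
  proof (rule T0_I[OF ad_endo[OF endo]])
    show "ad X y \<in> M" if "y \<in> M" for y
      by (rule M_memI)
        (simp add: hR_ad endo hR_M'_M T0_M' X that extend_lattice_pure e'_Ld)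
    show "ad X y \<in> M'" if "y \<in> M'" for y
      by (rule M'_memI)
        (simp add: hR_ad endo hR_M_M' T0_M X that extend_lattice_pure e_L)
  qed
qed

lemma ad_ad: "X \<in> T0 \<Longrightarrow> ad (ad X) = X"
  by (intro ad_eqI) (simp_all add: ad_endo T0_endo hR_ad_left)

lemma ad_add: "X \<in> T0 \<Longrightarrow> Y \<in> T0 \<Longrightarrow> ad (X + Y) = ad X + ad Y"
  using T0_endo[OF add_subgroupD(4)[OF T0_subgroup], of X Y]
  by (intro ad_eqI) (simp_all add: T0_endo hR_ad hR_simps)

lemma ad_comp: "X \<in> T0 \<Longrightarrow> Y \<in> T0 \<Longrightarrow> ad (X \<circ> Y) = ad Y \<circ> ad X"
  using T0_endo[OF T0_comp, of X Y] by (intro ad_eqI) (simp_all add: T0_endo hR_ad)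

end

section \<open>The two filtrations\<close>

lemma hermitian_formD:
  assumes "hermitian_form act \<sigma> \<epsilon> f"
  shows "biadditive f" "f (act x a) (act y b) = \<sigma> a * f x y * b" "f y x = \<epsilon> * \<sigma> (f x y)"
  using assms unfolding hermitian_form_def by blast+

lemma hermitian_form_zero: "additive \<sigma> \<Longrightarrow> hermitian_form act \<sigma> \<epsilon> 0"
  by (simp add: hermitian_form_def biadditive_def additive_def additive.zero)

lemma hermitian_form_add:
  assumes "additive \<sigma>" "hermitian_form act \<sigma> \<epsilon> f" "hermitian_form act \<sigma> \<epsilon> g"
  shows "hermitian_form act \<sigma> \<epsilon> (f + g)"
  unfolding hermitian_form_def
proof (intro conjI allI)
  note f = hermitian_formD[OF assms(2)] and g = hermitian_formD[OF assms(3)]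
  show "biadditive (f + g)"
    by (rule biadditiveI) (simp_all add: biadditive_simps[OF f(1)] biadditive_simps[OF g(1)])
  show "(f + g) (act x a) (act y b) = \<sigma> a * (f + g) x y * b" for x y a b
    by (simp add: f(2) g(2) distrib_left distrib_right)
  show "(f + g) y x = \<epsilon> * \<sigma> ((f + g) x y)" for x y
    by (simp add: f(3)[of y x] g(3)[of y x] additive.add[OF assms(1)] distrib_left)
qed

lemma hermitian_form_uminus:
  assumes "additive \<sigma>" "hermitian_form act \<sigma> \<epsilon> f"
  shows "hermitian_form act \<sigma> \<epsilon> (- f)"
  unfolding hermitian_form_def
proof (intro conjI allI)
  note f = hermitian_formD[OF assms(2)]
  show "biadditive (- f)"
    by (rule biadditiveI) (simp_all add: biadditive_simps[OF f(1)])
  show "(- f) (act x a) (act y b) = \<sigma> a * (- f) x y * b" for x y a b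
    by (simp add: f(2))
  show "(- f) y x = \<epsilon> * \<sigma> ((- f) x y)" for x y
    by (simp add: f(3)[of y x] additive.minus[OF assms(1)])
qed

lemma H_zero_herm_subgroup:
  assumes "additive \<sigma>" and C: "add_subgroup C"
  shows "add_subgroup (H_zero_herm act \<sigma> \<epsilon> C M M')"
proof (rule add_subgroupI)
  show "0 \<in> H_zero_herm act \<sigma> \<epsilon> C M M'"
    by (simp add: H_zero_herm_def add_subgroupD[OF C] hermitian_form_zero assms(1))
  show "f + g \<in> H_zero_herm act \<sigma> \<epsilon> C M M'"
    if "f \<in> H_zero_herm act \<sigma> \<epsilon> C M M'" "g \<in> H_zero_herm act \<sigma> \<epsilon> C M M'" for f g
    using that by (simp add: H_zero_herm_def add_subgroupD[OF C] hermitian_form_add assms(1))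
  show "- f \<in> H_zero_herm act \<sigma> \<epsilon> C M M'" if "f \<in> H_zero_herm act \<sigma> \<epsilon> C M M'" for f
    using that by (simp add: H_zero_herm_def add_subgroupD[OF C] hermitian_form_uminus assms(1))
qed

lemma assoc_bilinear_simps:
  "assoc_bilinear half 0 = 0"
  "assoc_bilinear half (f + g) = assoc_bilinear half f + assoc_bilinear half g"
  "assoc_bilinear half (- f) = - assoc_bilinear half f"
proof -
  show "assoc_bilinear half 0 = 0"
    by (intro ext) (simp add: assoc_bilinear_def)
  show "assoc_bilinear half (f + g) = assoc_bilinear half f + assoc_bilinear half g"
    by (intro ext) (simp add: assoc_bilinear_def algebra_simps)
  show "assoc_bilinear half (- f) = - assoc_bilinear half f"
    by (intro ext) (simp add: assoc_bilinear_def algebra_simps)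
qed

lemma H_zero_quad_subgroup:
  assumes C: "add_subgroup C"
  shows "add_subgroup (H_zero_quad act half C M M')"
proof (rule add_subgroupI)
  have id: "additive (id :: 's \<Rightarrow> 's::ab_group_add)"
    by (simp add: additive_def)
  show "0 \<in> H_zero_quad act half C M M'"
    by (simp add: H_zero_quad_def quadratic_form_def assoc_bilinear_simps add_subgroupD[OF C]
        hermitian_form_zero id)
  show "f + g \<in> H_zero_quad act half C M M'"
    if "f \<in> H_zero_quad act half C M M'" "g \<in> H_zero_quad act half C M M'" for f g
    using that by (simp add: H_zero_quad_def quadratic_form_def assoc_bilinear_simps add_subgroupD[OF C]
        hermitian_form_add id distrib_right)
  show "- f \<in> H_zero_quad act half C M M'" if "f \<in> H_zero_quad act half C M M'" for f
    using that by (simp add: H_zero_quad_def quadratic_form_def assoc_bilinear_simps add_subgroupD[OF C]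
        hermitian_form_uminus id)
qed

text \<open>Polarising the diagonal of a symmetric form gives twice the form, and
  \<open>half\<close> undoes the factor. Claims about \<open>phi_quad\<close> and
  \<open>psi_quad\<close> are thereby inherited from their bilinear counterparts.\<close>

lemma quadratic_form_diagonal:
  fixes b :: "'w::ab_group_add \<Rightarrow> 'w \<Rightarrow> 's::{ring,monoid_mult}"
  assumes b: "hermitian_form act id 1 b" and half: "half + half = 1"
    and comm: "\<And>x y :: 's. x * y = y * x"
  shows "assoc_bilinear half (\<lambda>x. b x x) = b" "quadratic_form act half (\<lambda>x. b x x)"
proof -
  note b' = hermitian_formD[OF b]
  show assoc: "assoc_bilinear half (\<lambda>x. b x x) = b"
  proof (intro ext)
    fix x y
    have "b (x + y) (x + y) - b x x - b y y = b x y + b x y"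
      using b'(3)[of y x] by (simp add: biadditive_simps[OF b'(1)])
    then show "assoc_bilinear half (\<lambda>x. b x x) x y = b x y"
      by (simp add: assoc_bilinear_def distrib_left distrib_right[symmetric] half)
  qed
  have "b (act x a) (act x a) = b x x * a ^ 2" for x a
    by (simp add: b'(2) power2_eq_square comm[of a "b x x"] mult.assoc)
  then show "quadratic_form act half (\<lambda>x. b x x)"
    by (simp add: quadratic_form_def assoc b)
qed

section \<open>The maps \<phi> and \<psi> in the hermitian and in the quadratic case\<close>

context base_changed_lattice
begin

lemma hermitian_phi:
  assumes X: "module_endo actR X"
  shows "hermitian_form actR \<sigma>R \<epsilon>R (phi_herm hR X)"
  unfolding hermitian_form_def
proof (intro conjI allI)
  show "biadditive (phi_herm hR X)"
    by (rule biadditiveI) (simp_all add: phi_herm_def module_endoD[OF X] hR_simps)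
  show "phi_herm hR X (actR x a) (actR y b) = \<sigma>R a * phi_herm hR X x y * b" for x y a b
    by (simp add: phi_herm_def module_endoD[OF X] hR_act_left hR_act_right mult.assoc)
  show "phi_herm hR X y x = \<epsilon>R * \<sigma>R (phi_herm hR X x y)" for x y
    by (simp only: phi_herm_def) (rule hR_sym)
qed

lemma hermitian_psi:
  assumes X: "module_endo actR X"
  shows "hermitian_form actR \<sigma>R \<epsilon>R (psi_herm hR X)"
  unfolding hermitian_form_def
proof (intro conjI allI)
  show "biadditive (psi_herm hR X)"
    by (rule biadditiveI) (simp_all add: psi_herm_def module_endoD[OF X] hR_simps add_ac)
  show "psi_herm hR X (actR x a) (actR y b) = \<sigma>R a * psi_herm hR X x y * b" for x y a b
    by (simp add: psi_herm_def module_endoD[OF X] hR_act_left hR_act_right distrib_left distrib_right mult.assoc)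
  show "psi_herm hR X y x = \<epsilon>R * \<sigma>R (psi_herm hR X x y)" for x y
    by (simp add: psi_herm_def additive.add[OF \<sigma>R(1)] distrib_left hR_sym[symmetric] add.commute)
qed

text \<open>Moving \<open>X\<close> across \<open>hR\<close> turns the cross terms
  \<open>hR (X x) (Y y)\<close> and \<open>hR (Y x) (X y)\<close> into the two summands of
  \<psi>.\<close>

lemma phi_herm_add:
  "X \<in> T0 \<Longrightarrow> Y \<in> T0 \<Longrightarrow>
    phi_herm hR (X + Y) = phi_herm hR X + phi_herm hR Y + psi_herm hR (ad X \<circ> Y)"
  by (intro ext) (simp add: phi_herm_def psi_herm_def hR_simps hR_ad hR_ad_left T0_endo add_ac)

lemma phi_herm_uminus: "phi_herm hR (- X) = phi_herm hR X"
  by (intro ext) (simp add: phi_herm_def hR_simps)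

lemma psi_herm_add: "psi_herm hR (X + Y) = psi_herm hR X + psi_herm hR Y"
  by (intro ext) (simp add: psi_herm_def hR_simps add_ac)

lemma phi_herm_comp: "phi_herm hR (X \<circ> Y) x y = phi_herm hR X (Y x) (Y y)"
  by (simp add: phi_herm_def)

text \<open>Moving \<open>ad Y\<close> across \<open>hR\<close> pulls the form of \<open>Z\<close>
  back along \<open>Y\<close>. With \<open>phi_herm_comp\<close>, the product law is the evaluation
  of an equality of forms at \<open>Y x\<close> and \<open>Y y\<close>.\<close>

lemma psi_herm_comp:
  "Y \<in> T0 \<Longrightarrow> psi_herm hR (ad Y \<circ> Z \<circ> Y) x y = psi_herm hR Z (Y x) (Y y)"
  by (simp add: psi_herm_def hR_ad hR_ad_left T0_endo)

lemma phi_herm_M_M': "X \<in> T0 \<Longrightarrow> x \<in> M \<Longrightarrow> y \<in> M' \<Longrightarrow> phi_herm hR X x y \<in> C"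
  by (simp add: phi_herm_def hR_M_M' T0_M T0_M')

lemma psi_herm_M_M': "X \<in> T0 \<Longrightarrow> x \<in> M \<Longrightarrow> y \<in> M' \<Longrightarrow> psi_herm hR X x y \<in> C"
  by (simp add: psi_herm_def hR_M_M' T0_M T0_M' add_subgroupD[OF C_subgroup])

lemma hermitian_filtration:
  assumes integral: "\<And>x y. x \<in> L \<Longrightarrow> y \<in> L \<Longrightarrow> h x y \<in> B"
  shows "form_filtration ad (phi_herm hR) (psi_herm hR) T0 (H_zero_herm actR \<sigma>R \<epsilon>R C M M')"
proof
  have hR_M_M: "hR x y \<in> C" if "x \<in> M" "y \<in> M" for x y
    using hR_extend_lattice[OF integral that] .
  show "phi_herm hR X \<in> H_zero_herm actR \<sigma>R \<epsilon>R C M M'" if "X \<in> T0" for X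
    using that by (auto simp: H_zero_herm_def hermitian_phi T0_endo phi_herm_M_M')
      (simp add: phi_herm_def hR_M_M T0_M)
  show "psi_herm hR X \<in> H_zero_herm actR \<sigma>R \<epsilon>R C M M'" if "X \<in> T0" for X
    using that by (auto simp: H_zero_herm_def hermitian_psi T0_endo psi_herm_M_M')
      (simp add: psi_herm_def hR_M_M T0_M add_subgroupD[OF C_subgroup])
  show "phi_herm hR (X \<circ> Y) = psi_herm hR (ad Y \<circ> Z \<circ> Y)"
    if "X \<in> T0" "Y \<in> T0" "Z \<in> T0" "phi_herm hR X = psi_herm hR Z" for X Y Z
    using that by (intro ext) (simp only: phi_herm_comp psi_herm_comp)
qed (rule T0_subgroup H_zero_herm_subgroup[OF \<sigma>R(1) C_subgroup] T0_comp T0_ad ad_ad ad_add ad_comp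
    phi_herm_add phi_herm_uminus psi_herm_add; assumption)+

text \<open>Integrality of the diagonal and of \<open>2h\<close> is what the quadratic case needs:
  \<phi> takes the value \<open>hR (X x) (X x)\<close>, and by symmetry \<psi> takes twice the value
  \<open>hR x (X x)\<close>.\<close>

lemma quadratic_filtration:
  assumes \<sigma>: "\<sigma> = id" and \<epsilon>: "\<epsilon> = 1" and comm: "\<And>x y :: 'k. x * y = y * x"
    and half: "half + half = 1"
    and integral: "\<And>x. x \<in> L \<Longrightarrow> h x x \<in> B" "\<And>x y. x \<in> L \<Longrightarrow> y \<in> L \<Longrightarrow> h x y + h x y \<in> B"
  shows "form_filtration ad (phi_quad (extend_quadratic tK tV h)) (psi_quad hR) T0
    (H_zero_quad actR (tK half 1) C M M')"
proof
  have phi: "phi_quad (extend_quadratic tK tV h) X = (\<lambda>x. phi_herm hR X x x)" for X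
    by (intro ext) (simp add: phi_quad_def extend_quadratic_def phi_herm_def)
  have psi: "psi_quad hR X = (\<lambda>x. psi_herm hR X x x)" for X
    by (intro ext) (simp add: psi_quad_def psi_herm_def)
  have \<sigma>R_id: "\<sigma>R = id"
  proof
    show "\<sigma>R x = id x" for x
      by (rule K.additive_eqI[OF \<sigma>R(1)]) (simp_all add: additive_def \<sigma>R(2), simp add: \<sigma>)
  qed
  have \<epsilon>R_one: "\<epsilon>R = 1"
    by (simp add: \<epsilon> tK_one)
  have halfR: "tK half 1 + tK half 1 = 1"
    by (simp add: tK_simps(1)[symmetric] half tK_one)
  have commR: "a * b = b * a" for a b :: 's
  proof (rule K.additive_eqI[OF additive_mult_right additive_mult_left])
    fix x r
    show "tK x r * b = b * tK x r"
      by (rule K.additive_eqI[OF additive_mult_left additive_mult_right])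
        (simp add: tK_mult comm[of x] mult.commute)
  qed
  have twice: "hR x y + hR x y \<in> C" if x: "x \<in> M" and y: "y \<in> M" for x y
  proof -
    have pure: "hR (tV v r) y + hR (tV v r) y \<in> C" if v: "v \<in> L" for v r
    proof -
      have "add_subgroup {y. hR (tV v r) y + hR (tV v r) y \<in> C}"
        by (intro add_subgroup_vimage additive_intros C_subgroup)
      with y have "y \<in> {y. hR (tV v r) y + hR (tV v r) y \<in> C}"
        by (rule extend_lattice_induct)
          (simp add: hR tK_simps(1)[symmetric] extend_lattice_pure integral(2) v)
      then show ?thesis
        by simp
    qed
    have "add_subgroup {x. hR x y + hR x y \<in> C}"
      by (intro add_subgroup_vimage additive_intros C_subgroup)
    with x have "x \<in> {x. hR x y + hR x y \<in> C}"
      by (rule extend_lattice_induct) (simp add: pure)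
    then show ?thesis
      by simp
  qed
  have sym: "hR y x = hR x y" for x y
    using hR_sym[of y x] by (simp add: \<sigma>R_id \<epsilon>R_one)
  have diag: "hR x x \<in> C" if "x \<in> M" for x
  proof -
    note C = add_subgroupD[OF C_subgroup]
    \<comment> \<open>The diagonal is not additive, but the cross term of a sum is twice a value of
      \<open>hR\<close>, so \<open>twice\<close> still makes this set a subgroup.\<close>
    have "add_subgroup {x \<in> M. hR x x \<in> C}"
    proof (rule add_subgroupI)
      fix x y assume xy: "x \<in> {x \<in> M. hR x x \<in> C}" "y \<in> {x \<in> M. hR x x \<in> C}"
      have "hR (x + y) (x + y) = hR x x + hR y y + (hR x y + hR x y)"
        by (simp add: hR_simps sym[of y x] add_ac)
      then show "x + y \<in> {x \<in> M. hR x x \<in> C}"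
        using xy twice[of x y] by (simp add: add_subgroupD[OF M_subgroup] C)
    qed (simp_all add: hR_simps add_subgroupD[OF M_subgroup] C)
    with that have "x \<in> {x \<in> M. hR x x \<in> C}"
      by (rule extend_lattice_induct) (simp add: hR extend_lattice_pure integral(1))
    then show ?thesis
      by simp
  qed
  note diagonal = quadratic_form_diagonal[OF _ halfR commR]
  show "add_subgroup (H_zero_quad actR (tK half 1) C M M')"
    by (rule H_zero_quad_subgroup[OF C_subgroup])
  show "phi_quad (extend_quadratic tK tV h) X \<in> H_zero_quad actR (tK half 1) C M M'" if X: "X \<in> T0" for X
  proof -
    have herm: "hermitian_form actR id 1 (phi_herm hR X)"
      using hermitian_phi[OF T0_endo[OF X]] by (simp add: \<sigma>R_id \<epsilon>R_one)
    have "phi_herm hR X x x \<in> C" if "x \<in> M" for x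
      using that X by (simp add: phi_herm_def diag T0_M)
    then show ?thesis
      using phi_herm_M_M'[OF X] by (simp add: H_zero_quad_def phi diagonal[OF herm])
  qed
  show "psi_quad hR X \<in> H_zero_quad actR (tK half 1) C M M'" if X: "X \<in> T0" for X
  proof -
    have herm: "hermitian_form actR id 1 (psi_herm hR X)"
      using hermitian_psi[OF T0_endo[OF X]] by (simp add: \<sigma>R_id \<epsilon>R_one)
    have "psi_herm hR X x x \<in> C" if "x \<in> M" for x
      using twice[OF that T0_M[OF X that]] by (simp add: psi_herm_def sym[of "X x" x])
    then show ?thesis
      using psi_herm_M_M'[OF X] by (simp add: H_zero_quad_def psi diagonal[OF herm])
  qed
  show "phi_quad (extend_quadratic tK tV h) (X \<circ> Y) = psi_quad hR (ad Y \<circ> Z \<circ> Y)"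
    if XYZ: "X \<in> T0" "Y \<in> T0" "Z \<in> T0" and eq: "phi_quad (extend_quadratic tK tV h) X = psi_quad hR Z" for X Y Z
  proof (intro ext)
    fix x
    have "phi_quad (extend_quadratic tK tV h) (X \<circ> Y) x = phi_quad (extend_quadratic tK tV h) X (Y x)"
      by (simp only: phi phi_herm_comp)
    also have "\<dots> = psi_quad hR (ad Y \<circ> Z \<circ> Y) x"
      by (simp only: eq psi psi_herm_comp[OF XYZ(2)])
    finally show "phi_quad (extend_quadratic tK tV h) (X \<circ> Y) x = psi_quad hR (ad Y \<circ> Z \<circ> Y) x" .
  qed
  show "phi_quad (extend_quadratic tK tV h) (X + Y) =
      phi_quad (extend_quadratic tK tV h) X + phi_quad (extend_quadratic tK tV h) Y + psi_quad hR (ad X \<circ> Y)"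
    if "X \<in> T0" "Y \<in> T0" for X Y
    using phi_herm_add[OF that] by (intro ext) (simp add: phi psi del: comp_apply)
  show "psi_quad hR (X + Y) = psi_quad hR X + psi_quad hR Y" for X Y
    by (intro ext) (simp add: psi psi_herm_add)
  show "phi_quad (extend_quadratic tK tV h) (- X) = phi_quad (extend_quadratic tK tV h) X" for X
    by (intro ext) (simp add: phi phi_herm_uminus)
qed (rule T0_subgroup T0_comp T0_ad ad_ad ad_add ad_comp; assumption)+

text \<open>The first clause records what well-definedness of \<open>T (Suc m)\<close> means: the
  adjoint of \<open>X\<close> exists uniquely and lies in \<open>T 0\<close>, and \<phi> sends both
  \<open>X\<close> and its adjoint into the group of forms.\<close>

lemma filtration_conclusion:
  assumes "form_filtration ad \<phi> \<psi> T0 H0"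
  defines "T \<equiv> T_filtration ad \<phi> \<psi> T0"
  shows "\<forall>m. (\<forall>X\<in>T m. (\<exists>!Y. is_adjoint actR hR X Y) \<and> ad X \<in> T 0 \<and> \<phi> X \<in> H0 \<and> \<phi> (ad X) \<in> H0) \<and>
    \<psi> ` T m \<lhd> add_group H0 \<and>
    group (add_group (T m)) \<and> group (add_group (T (Suc m))) \<and>
    (\<forall>X\<in>T m. \<forall>Y\<in>T m. ad X \<circ> Y \<in> T m) \<and>
    \<psi> \<in> hom (add_group (T m)) (add_group H0) \<and>
    (\<lambda>X. (\<psi> ` T m) #>\<^bsub>add_group H0\<^esub> \<phi> X) \<in> hom (add_group (T m)) (add_group H0 Mod (\<psi> ` T m))"
proof (rule allI)
  fix m
  interpret F: form_filtration ad \<phi> \<psi> T0 H0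
    by (rule assms(1))
  have "\<forall>X\<in>T m. (\<exists>!Y. is_adjoint actR hR X Y) \<and> ad X \<in> T 0 \<and> \<phi> X \<in> H0 \<and> \<phi> (ad X) \<in> H0"
  proof (rule ballI)
    fix X assume "X \<in> T m"
    then have X: "X \<in> T0"
      using F.T_subset unfolding T_def by blast
    have T_0: "T 0 = T0"
      by (simp add: T_def)
    show "(\<exists>!Y. is_adjoint actR hR X Y) \<and> ad X \<in> T 0 \<and> \<phi> X \<in> H0 \<and> \<phi> (ad X) \<in> H0"
      unfolding T_0
      by (intro conjI adjoint_exists T0_endo T0_ad F.\<phi>_closed X)
  qed
  with F.filtration_homs[of m, folded T_def] show "(\<forall>X\<in>T m. (\<exists>!Y. is_adjoint actR hR X Y) \<and> ad X \<in> T 0 \<and> \<phi> X \<in> H0 \<and> \<phi> (ad X) \<in> H0) \<and>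
    \<psi> ` T m \<lhd> add_group H0 \<and>
    group (add_group (T m)) \<and> group (add_group (T (Suc m))) \<and>
    (\<forall>X\<in>T m. \<forall>Y\<in>T m. ad X \<circ> Y \<in> T m) \<and>
    \<psi> \<in> hom (add_group (T m)) (add_group H0) \<and>
    (\<lambda>X. (\<psi> ` T m) #>\<^bsub>add_group H0\<^esub> \<phi> X) \<in> hom (add_group (T m)) (add_group H0 Mod (\<psi> ` T m))"
    by (intro conjI) simp_all
qed

end

section \<open>The local field and the algebra with involution\<close>

lemma val_ring_mult:
  assumes "nonarch_local_field \<nu>" "a \<in> val_ring \<nu>" "b \<in> val_ring \<nu>"
  shows "a * b \<in> val_ring \<nu>"
proof -
  have "\<nu> (a * b) = \<nu> a + \<nu> b" if "a \<noteq> 0" "b \<noteq> 0"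
    using assms(1) that unfolding nonarch_local_field_def by blast
  then show ?thesis
    using assms(2,3) by (cases "a = 0 \<or> b = 0") (auto simp: val_ge_def)
qed

lemma val_ring_inverse:
  assumes "nonarch_local_field \<nu>" "a \<noteq> 0"
  shows "a \<in> val_ring \<nu> \<or> inverse a \<in> val_ring \<nu>"
proof -
  have mult: "\<nu> (x * y) = \<nu> x + \<nu> y" if "x \<noteq> 0" "y \<noteq> 0" for x y
    using assms(1) that unfolding nonarch_local_field_def by blast
  have "\<nu> 1 = 0"
    using mult[of 1 1] by simp
  then have "\<nu> a + \<nu> (inverse a) = 0"
    using mult[of a "inverse a"] assms(2) by simp
  then show ?thesis
    by (auto simp: val_ge_def)
qed

text \<open>In the first three cases \<open>K\<close> is commutative, so a multiplicative \<sigma>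
  also reverses products; for the base field, commutativity holds because \<iota> maps onto
  \<open>K\<close> and into the centre. In the split case the identities are compared in
  \<open>F \<times> F\<close>.\<close>

lemma involution_properties:
  fixes \<iota> :: "'f::field \<Rightarrow> 'k::ring_1"
  assumes "algebra_with_involution \<iota> \<sigma>"
  shows "additive \<sigma>" "\<sigma> (x * y) = \<sigma> y * \<sigma> x" "\<sigma> (\<iota> a) = \<iota> a"
proof -
  have center: "range \<iota> \<subseteq> ring_center"
    and cases: "base_field_case \<iota> \<sigma> \<or> separable_quadratic_case \<iota> \<sigma> \<or> split_case \<iota> \<sigma> \<or> quaternion_case \<iota> \<sigma>"
    using assms by (auto simp: algebra_with_involution_def)
  from cases have "additive \<sigma> \<and> (\<forall>x y. \<sigma> (x * y) = \<sigma> y * \<sigma> x) \<and> (\<forall>a. \<sigma> (\<iota> a) = \<iota> a)"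
  proof (elim disjE)
    assume base: "base_field_case \<iota> \<sigma>"
    have "x * y = y * x" for x y :: 'k
    proof -
      have "x \<in> ring_center"
        using base center unfolding base_field_case_def by (metis UNIV_I bij_is_surj subsetD)
      then show ?thesis
        by (simp add: ring_center_def)
    qed
    then show ?thesis
      using base by (auto simp: base_field_case_def additive_def)
  next
    assume "separable_quadratic_case \<iota> \<sigma>"
    then show ?thesis
      unfolding separable_quadratic_case_def unital_ring_hom_on_def additive_def by (metis UNIV_I)
  next
    assume "split_case \<iota> \<sigma>"
    then obtain \<Phi> where \<Phi>: "bij \<Phi>"
      "\<And>x y. \<Phi> (x + y) = (fst (\<Phi> x) + fst (\<Phi> y), snd (\<Phi> x) + snd (\<Phi> y))"
      "\<And>x y. \<Phi> (x * y) = (fst (\<Phi> x) * fst (\<Phi> y), snd (\<Phi> x) * snd (\<Phi> y))"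
      "\<And>a. \<Phi> (\<iota> a) = (a, a)" "\<And>x. \<Phi> (\<sigma> x) = prod.swap (\<Phi> x)"
      unfolding split_case_def by blast
    have eqI: "x = y" if "\<Phi> x = \<Phi> y" for x y
      using \<Phi>(1) that by (metis bij_is_inj injD)
    show ?thesis
      unfolding additive_def
      by (intro conjI allI eqI) (simp_all add: \<Phi>(2-5) mult.commute)
  next
    assume "quaternion_case \<iota> \<sigma>"
    then show ?thesis
      unfolding quaternion_case_def by blast
  qed
  then show "additive \<sigma>" "\<sigma> (x * y) = \<sigma> y * \<sigma> x" "\<sigma> (\<iota> a) = \<iota> a"
    by blast+
qed

theorem theorem3p9:
  fixes \<nu> :: "'f::field \<Rightarrow> int"
    and \<iota> :: "'f \<Rightarrow> 'k::ring_1"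
    and \<sigma> :: "'k \<Rightarrow> 'k"
    and \<epsilon> :: 'k
    and B :: "'k set"
    and act :: "'v::ab_group_add \<Rightarrow> 'k \<Rightarrow> 'v"
    and L :: "'v set"
    and n :: nat
    and \<alpha> :: "'f \<Rightarrow> 'r::{comm_ring,comm_monoid_mult}"
    and tK :: "'k \<Rightarrow> 'r \<Rightarrow> 's::{ring,monoid_mult}"
    and tV :: "'v \<Rightarrow> 'r \<Rightarrow> 'w::ab_group_add"
  assumes "nonarch_local_field \<nu>"
    and "algebra_with_involution \<iota> \<sigma>"
    and "is_maximal_order (val_ring \<nu>) \<iota> B"
    and "\<epsilon> \<in> {1, -1}"
    and "right_module act"
    and "free_lattice \<iota> act B n L"
    and "etale_algebra (val_ring \<nu>) \<alpha>"
    and "is_base_changed_algebra (val_ring \<nu>) \<iota> \<alpha> tK"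
    and "is_base_changed_module (val_ring \<nu>) \<iota> act \<alpha> tV"
  shows
    "(\<not> (base_field_case \<iota> \<sigma> \<and> \<epsilon> = 1 \<and> residue_char \<nu> = 2) \<longrightarrow>
       (\<forall>h. hermitian_form act \<sigma> \<epsilon> h \<and> (\<forall>x\<in>L. \<forall>y\<in>L. h x y \<in> B) \<and> nondegenerate h \<and>
            dual_lattice h B (dual_lattice h B L) = L \<longrightarrow>
          (let hR = extend_form tK tV h;
               actR = extend_action tK tV act;
               \<sigma>R = extend_involution tK \<sigma>;
               BR = extend_lattice tK B;
               M = extend_lattice tV L;
               M' = extend_lattice tV (dual_lattice h B L);
               H0 = H_zero_herm actR \<sigma>R (tK \<epsilon> 1) BR M M';
               T = T_filtration (adj actR hR) (phi_herm hR) (psi_herm hR) (T_zero actR M M')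
           in \<forall>m.
                (\<forall>X\<in>T m. (\<exists>!Y. is_adjoint actR hR X Y) \<and> adj actR hR X \<in> T 0 \<and>
                   phi_herm hR X \<in> H0 \<and> phi_herm hR (adj actR hR X) \<in> H0) \<and>
                psi_herm hR ` T m \<lhd> add_group H0 \<and>
                group (add_group (T m)) \<and> group (add_group (T (Suc m))) \<and>
                (\<forall>X\<in>T m. \<forall>Y\<in>T m. adj actR hR X \<circ> Y \<in> T m) \<and>
                psi_herm hR \<in> hom (add_group (T m)) (add_group H0) \<and>
                (\<lambda>X. (psi_herm hR ` T m) #>\<^bsub>add_group H0\<^esub> phi_herm hR X)
                  \<in> hom (add_group (T m)) (add_group H0 Mod (psi_herm hR ` T m))))) \<and>
     (base_field_case \<iota> \<sigma> \<and> \<epsilon> = 1 \<and> residue_char \<nu> = 2 \<longrightarrow>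
       (\<forall>q h. quadratic_form act (\<iota> (1 / 2)) q \<and> (\<forall>x\<in>L. q x \<in> B) \<and>
            h = assoc_bilinear (\<iota> (1 / 2)) q \<and> nondegenerate h \<and>
            dual_lattice h B (dual_lattice h B L) = L \<longrightarrow>
          (let hR = extend_form tK tV h;
               qR = extend_quadratic tK tV h;
               actR = extend_action tK tV act;
               BR = extend_lattice tK B;
               M = extend_lattice tV L;
               M' = extend_lattice tV (dual_lattice h B L);
               H0 = H_zero_quad actR (tK (\<iota> (1 / 2)) 1) BR M M';
               T = T_filtration (adj actR hR) (phi_quad qR) (psi_quad hR) (T_zero actR M M')
           in \<forall>m.
                (\<forall>X\<in>T m. (\<exists>!Y. is_adjoint actR hR X Y) \<and> adj actR hR X \<in> T 0 \<and>
                   phi_quad qR X \<in> H0 \<and> phi_quad qR (adj actR hR X) \<in> H0) \<and>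
                psi_quad hR ` T m \<lhd> add_group H0 \<and>
                group (add_group (T m)) \<and> group (add_group (T (Suc m))) \<and>
                (\<forall>X\<in>T m. \<forall>Y\<in>T m. adj actR hR X \<circ> Y \<in> T m) \<and>
                psi_quad hR \<in> hom (add_group (T m)) (add_group H0) \<and>
                (\<lambda>X. (psi_quad hR ` T m) #>\<^bsub>add_group H0\<^esub> phi_quad qR X)
                  \<in> hom (add_group (T m)) (add_group H0 Mod (psi_quad hR ` T m)))))"
proof (intro conjI impI allI, goal_cases)
  note involution = involution_properties[OF assms(2)]
  \<comment> \<open>Both cases provide the same lattice data; integrality of the form is fed in
    separately.\<close>
  have lattice: "base_changed_lattice (val_ring \<nu>) \<iota> \<sigma> \<epsilon> B act L n h \<alpha> tK tV"
    if h: "hermitian_form act \<sigma> \<epsilon> h" "nondegenerate h" "dual_lattice h B (dual_lattice h B L) = L" for h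
  proof
    show "a * b \<in> val_ring \<nu>" if "a \<in> val_ring \<nu>" "b \<in> val_ring \<nu>" for a b
      by (rule val_ring_mult[OF assms(1) that])
    show "a \<in> val_ring \<nu> \<or> inverse a \<in> val_ring \<nu>" if "a \<noteq> 0" for a
      by (rule val_ring_inverse[OF assms(1) that])
    show "unital_ring_hom_on UNIV \<iota>" "range \<iota> \<subseteq> ring_center"
      using assms(2) by (auto simp: algebra_with_involution_def)
    show "is_order (val_ring \<nu>) \<iota> B"
      using assms(3) by (simp add: is_maximal_order_def)
  qed (rule additive.add[OF involution(1)] involution(2,3) assms h)+
  {
    case (1 h)
    then interpret base_changed_lattice "val_ring \<nu>" \<iota> \<sigma> \<epsilon> B act L n h \<alpha> tK tV
      by (intro lattice) blast+
    have "form_filtration ad (phi_herm hR) (psi_herm hR) T0 (H_zero_herm actR \<sigma>R \<epsilon>R C M M')"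
      using 1 by (intro hermitian_filtration) blast
    then show ?case
      unfolding Let_def by (rule filtration_conclusion)
  next
    case (2 q h)
    then have \<sigma>: "\<sigma> = id" and \<epsilon>: "\<epsilon> = 1" and \<iota>: "bij \<iota>" and char: "CHAR('f) \<noteq> 2"
      and q: "quadratic_form act (\<iota> (1 / 2)) q" and h: "h = assoc_bilinear (\<iota> (1 / 2)) q"
      and qB: "\<And>x. x \<in> L \<Longrightarrow> q x \<in> B"
      by (auto simp: base_field_case_def)
    then interpret base_changed_lattice "val_ring \<nu>" \<iota> \<sigma> \<epsilon> B act L n h \<alpha> tK tV
      using 2 by (intro lattice) (auto simp: quadratic_form_def)
    have comm: "x * y = y * x" for x y :: 'k
      using \<iota>_commute[of x] \<iota> by (metis bij_pointE)
    \<comment> \<open>This makes \<open>1 / 2\<close> a true half. Among the possible values 0, 1, 2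
      the first does not divide 2, the second is impossible in a field, and the third is excluded by
      assumption.\<close>
    have "\<not> CHAR('f) dvd 2"
    proof
      assume dvd: "CHAR('f) dvd 2"
      have "CHAR('f) \<le> 2"
        by (rule dvd_imp_le[OF dvd]) simp
      moreover have "CHAR('f) \<noteq> 0"
        using dvd by (intro notI) simp
      moreover have "CHAR('f) \<noteq> Suc 0"
        by simp
      ultimately show False
        using char by linarith
    qed
    then have two: "(2 :: 'f) \<noteq> 0"
      using of_nat_eq_0_iff_char_dvd[where ?'a = 'f, of 2] by simp
    have half: "\<iota> (1 / 2) + \<iota> (1 / 2) = 1"
    proof -
      have "\<iota> (1 / 2) + \<iota> (1 / 2) = \<iota> (1 / 2 + 1 / 2)"
        by (simp only: \<iota>_simps)
      also have "1 / 2 + 1 / 2 = (1 :: 'f)"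
        using two by (simp add: field_simps)
      finally show ?thesis
        by (simp only: \<iota>_simps)
    qed
    \<comment> \<open>Doubling removes the factor 1/2, so that integrality of \<open>q\<close> on
      \<open>L\<close> makes \<open>2h\<close> integral there.\<close>
    have double: "h x y + h x y = q (x + y) - q x - q y" for x y
      by (simp only: h assoc_bilinear_def distrib_right[symmetric] half mult_1_left)
    \<comment> \<open>Homogeneity at the scalar \<open>1 + 1\<close> gives
      \<open>q (x + x) = 4 q x\<close>, so \<open>h x x\<close> and \<open>q x\<close> have the same
      double, and multiplication by the half cancels it.\<close>
    have "h x x = q x" for x
    proof -
      have "q (x + x) = q (act x (1 + 1))"
        by (simp only: act_simps act_one)
      also have "\<dots> = q x * (1 + 1) ^ 2"
        using q by (simp only: quadratic_form_def)
      also have "\<dots> = q x + q x + q x + q x"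
        by (simp add: power2_eq_square distrib_left distrib_right add.assoc del: one_add_one)
      finally have "h x x + h x x = q x + q x"
        by (simp add: double)
      then have "(\<iota> (1 / 2) + \<iota> (1 / 2)) * h x x = (\<iota> (1 / 2) + \<iota> (1 / 2)) * q x"
        by (simp only: distrib_right) (simp only: distrib_left[symmetric])
      then show ?thesis
        by (simp only: half mult_1_left)
    qed
    then have "form_filtration ad (phi_quad (extend_quadratic tK tV h)) (psi_quad hR) T0
        (H_zero_quad actR (tK (\<iota> (1 / 2)) 1) C M M')"
      using qB by (intro quadratic_filtration \<sigma> \<epsilon> comm half) (simp_all add: double B_closed L_add)
    then show ?case
      unfolding Let_def by (rule filtration_conclusion)
  }
qed

end
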